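(* Let $p$ be a prime, $h\ge 1$ an integer and $q=p^h$. Let $\mathbb{K}$ be an algebraically closed field of characteristic $p$, and let $\mathbb{K}(\mathcal H_q)=\mathbb{K}(x,y)$ be the function field of the Hermitian curve $\mathcal H_q$, where $x,y$ satisfy $y^q+y-x^{q+1}=0$. Let $G$ be the group of all $\mathbb{K}$-automorphisms of $\mathbb{K}(\mathcal H_q)$. Then the fixed field $\mathbb{K}(\mathcal H_q)^G=\{f\in \mathbb{K}(\mathcal H_q): \sigma(f)=f \text{ for all } \sigma\in G\}$ equals $\mathbb{K}(t)$, where $$t=\frac{y+y^{q^5}-x^{q^5+1}}{y+y^{q^3}-x^{q^3+1}}\left(\frac{\begin{vmatrix} x & x^{q^2} & x^{q^6} \\ y & y^{q^2} & y^{q^6} \\ 1 & 1 & 1 \end{vmatrix}}{\begin{vmatrix} x & x^{q^4} & x^{q^6} \\ y & y^{q^4} & y^{q^6} \\ 1 & 1 & 1 \end{vmatrix}}\right)^q.$$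
   Context: It is well known that the $\mathbb{K}$-automorphism group $G$ of the Hermitian function field is isomorphic to the projective unitary group $\mathrm{PGU}(3,q)$ over $\mathbb{F}_{q^2}$.
   Formalization: The case q = 2 is excluded: there the curve y^2+y=x^3 is elliptic, its translations make the group G of all K-automorphisms infinite, so the fixed field is K, while t is non-constant; the statement is false for q = 2. *)

theory Defs
  imports
    "HOL-Computational_Algebra.Computational_Algebra"
    "HOL-Analysis.Determinants"
begin

definition is_ring_hom :: "('a::comm_ring_1 \<Rightarrow> 'b::comm_ring_1) \<Rightarrow> bool" where
  "is_ring_hom \<phi> \<longleftrightarrow>
     \<phi> 1 = 1 \<and> (\<forall>a b. \<phi> (a + b) = \<phi> a + \<phi> b) \<and> (\<forall>a b. \<phi> (a * b) = \<phi> a * \<phi> b)"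

definition is_subfield :: "'f::field set \<Rightarrow> bool" where
  "is_subfield S \<longleftrightarrow>
     0 \<in> S \<and> 1 \<in> S \<and>
     (\<forall>a\<in>S. \<forall>b\<in>S. a + b \<in> S \<and> a - b \<in> S \<and> a * b \<in> S) \<and>
     (\<forall>a\<in>S. inverse a \<in> S)"

text \<open>
  A field extension \<open>F/K\<close> is given by a ring homomorphism \<open>\<iota>\<close> from the type \<open>'k\<close> of
  elements of \<open>K\<close> to the type \<open>'f\<close> of elements of \<open>F\<close>; it is automatically injective, and
  \<open>K\<close> is identified with \<open>range \<iota>\<close>. The next definition is \<open>K(A)\<close>.
\<close>

definition field_adjoin :: "('k::field \<Rightarrow> 'f::field) \<Rightarrow> 'f set \<Rightarrow> 'f set" where
  "field_adjoin \<iota> A = \<Inter> {S. is_subfield S \<and> range \<iota> \<subseteq> S \<and> A \<subseteq> S}"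

definition field_automorphisms :: "('k::field \<Rightarrow> 'f::field) \<Rightarrow> ('f \<Rightarrow> 'f) set" where
  "field_automorphisms \<iota> = {\<sigma>. bij \<sigma> \<and> is_ring_hom \<sigma> \<and> (\<forall>c. \<sigma> (\<iota> c) = \<iota> c)}"

definition fixed_field :: "('f \<Rightarrow> 'f) set \<Rightarrow> 'f set" where
  "fixed_field G = {f. \<forall>\<sigma>\<in>G. \<sigma> f = f}"

text \<open>
  Elements of \<open>K[X,Y]\<close> are represented in \<open>K[X][Y]\<close>: the outer variable is \<open>Y\<close>, the
  coefficients are polynomials in \<open>X\<close>.
\<close>

definition eval2 :: "('k::field \<Rightarrow> 'f::field) \<Rightarrow> 'f \<Rightarrow> 'f \<Rightarrow> 'k poly poly \<Rightarrow> 'f" where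
  "eval2 \<iota> x y P = poly (map_poly (\<lambda>c. poly (map_poly \<iota> c) x) P) y"

text \<open>The polynomial \<open>Y^q + Y - X^(q+1)\<close>.\<close>

definition hermitian_poly :: "nat \<Rightarrow> 'k::field poly poly" where
  "hermitian_poly q = monom 1 q + monom 1 1 - [:monom 1 (q + 1):]"

text \<open>
  The extension \<open>\<iota>\<close> is the function field of the Hermitian curve with coordinate functions
  \<open>x\<close> and \<open>y\<close>, i.e. the field of fractions of \<open>K[X,Y]/(Y^q + Y - X^(q+1))\<close>, where \<open>x\<close> and \<open>y\<close>
  are the residue classes of \<open>X\<close> and \<open>Y\<close>: it is generated by \<open>x\<close> and \<open>y\<close>, and the kernel of
  the evaluation at \<open>(x,y)\<close> is the principal ideal generated by the curve equation.
\<close>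

definition hermitian_function_field ::
    "nat \<Rightarrow> ('k::field \<Rightarrow> 'f::field) \<Rightarrow> 'f \<Rightarrow> 'f \<Rightarrow> bool" where
  "hermitian_function_field q \<iota> x y \<longleftrightarrow>
     is_ring_hom \<iota> \<and>
     field_adjoin \<iota> {x, y} = UNIV \<and>
     (\<forall>P. eval2 \<iota> x y P = 0 \<longleftrightarrow> hermitian_poly q dvd P)"

definition hermitian_t :: "nat \<Rightarrow> 'f::field \<Rightarrow> 'f \<Rightarrow> 'f" where
  "hermitian_t q x y =
     (y + y ^ (q ^ 5) - x ^ (q ^ 5 + 1)) / (y + y ^ (q ^ 3) - x ^ (q ^ 3 + 1)) *
     (det (vector [vector [x, x ^ (q ^ 2), x ^ (q ^ 6)],
                   vector [y, y ^ (q ^ 2), y ^ (q ^ 6)],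
                   vector [1, 1, 1]] :: 'f ^ 3 ^ 3) /
      det (vector [vector [x, x ^ (q ^ 4), x ^ (q ^ 6)],
                   vector [y, y ^ (q ^ 4), y ^ (q ^ 6)],
                   vector [1, 1, 1]] :: 'f ^ 3 ^ 3)) ^ q"

end

theory Submission
  imports Defs
begin

text \<open>
  Put \<open>w = x^(q^2) - x\<close> and \<open>u = w^(q^2 - 1)\<close>. Repeated use of the curve equation turns every factor
  of \<open>t\<close> into a polynomial in \<open>w\<close>, and \<open>t = (1 + u^q + u^(q + 1))^(q^2 - q + 1) / u^(q^3)\<close>.

  An element fixed by all automorphisms descends along \<open>K(x,y) \<supseteq> K(x) \<supseteq> K(w) \<supseteq> K(u) \<supseteq> K(t)\<close>: each step
  is generated by a root of a polynomial of degree \<open>q\<close>, \<open>q^2\<close>, \<open>q^2 - 1\<close> and \<open>q^3 + 1\<close>, respectively,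
  that has as many conjugates as its degree under the maps \<open>(x + a, y + a^q x + b)\<close>,
  \<open>(c x, c^(q + 1) y)\<close> and \<open>J = (x / y, 1 / y)\<close> of the projective unitary group.

  Conversely, \<open>t\<close> is fixed by \<open>J\<close> and, being a function of \<open>u\<close>, by every automorphism that fixes the
  place at infinity: such an automorphism preserves the pole orders \<open>q\<close> of \<open>x\<close> and \<open>q + 1\<close> of \<open>y\<close>, hence
  acts by an affine map whose \<open>x\<close>-part has coefficients in \<open>F_(q^2)\<close>. It remains to see that
  the image of infinity under an automorphism is an \<open>F_(q^2)\<close>-rational place, because translations and \<open>J\<close> move
  rational places to infinity. This is where \<open>q > 2\<close> is needed: a conic cannot meet the tangent at
  a non-rational point in the way that the image of \<open>y\<close> would force it to.
\<close>

section \<open>Ring homomorphisms, subfields and descent\<close>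

text \<open>For \<open>q = 2\<close> the curve is elliptic: the translations of its group law form
  an infinite group, and only the constants are fixed by all automorphisms. So the case has to be
  excluded, and the argument that controls an arbitrary automorphism must fail for it.

  The degrees of the four descent steps multiply to q^3 (q^2 - 1) (q^3 + 1), the order of PGU(3,q).
  In each step the degree bounds the number of conjugates from above and explicit automorphisms
  bound it from below; that the two bounds agree takes the place of irreducibility.

  Arbitrary automorphisms are controlled by two elementary facts. Every valuation trivial on the
  constants belongs to an affine point or to infinity. And an element with poles only at infinity is
  a polynomial in x and y of degree less than q in y, whose terms c(x) y^j have pole orders that
  differ modulo q for different j; hence a bound on the pole order bounds every term
  separately.\<close>

lemma is_ring_hom_simps:
  assumes "is_ring_hom \<phi>"
  shows "\<phi> 0 = 0" "\<phi> 1 = 1" "\<phi> (a + b) = \<phi> a + \<phi> b" "\<phi> (a * b) = \<phi> a * \<phi> b"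
    "\<phi> (- a) = - \<phi> a" "\<phi> (a - b) = \<phi> a - \<phi> b" "\<phi> (a ^ n) = \<phi> a ^ n"
proof -
  have add: "\<phi> (a + b) = \<phi> a + \<phi> b" and mult: "\<phi> (a * b) = \<phi> a * \<phi> b" for a b
    using assms by (auto simp: is_ring_hom_def)
  show one: "\<phi> 1 = 1" using assms by (auto simp: is_ring_hom_def)
  show zero: "\<phi> 0 = 0" using add[of 0 0] by simp
  show uminus: "\<phi> (- a) = - \<phi> a" for a
    using add[of a "- a"] zero by (simp add: add_eq_0_iff2 minus_equation_iff)
  show "\<phi> (a - b) = \<phi> a - \<phi> b" using add[of a "- b"] uminus by simp
  show "\<phi> (a ^ n) = \<phi> a ^ n" by (induction n) (auto simp: one mult)
qed (use assms in \<open>auto simp: is_ring_hom_def\<close>)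

lemma is_ring_hom_sum:
  assumes "is_ring_hom \<phi>"
  shows "\<phi> (sum f A) = (\<Sum>i\<in>A. \<phi> (f i))"
  by (induction A rule: infinite_finite_induct) (auto simp: is_ring_hom_simps[OF assms])

lemma is_ring_hom_field_simps:
  fixes \<phi> :: "'a::field \<Rightarrow> 'b::field"
  assumes "is_ring_hom \<phi>"
  shows "\<phi> a = 0 \<longleftrightarrow> a = 0" "\<phi> (inverse a) = inverse (\<phi> a)" "\<phi> (a / b) = \<phi> a / \<phi> b"
    "\<phi> a = \<phi> b \<longleftrightarrow> a = b"
proof -
  note hom = is_ring_hom_simps[OF assms]
  have inv: "\<phi> a * \<phi> (inverse a) = 1" if "a \<noteq> 0" for a
    using that hom(2,4) by (metis right_inverse)
  show zero: "\<phi> a = 0 \<longleftrightarrow> a = 0" for a using inv[of a] hom(1) by (metis mult_zero_left zero_neq_one)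
  show inverse: "\<phi> (inverse a) = inverse (\<phi> a)" for a
    by (cases "a = 0") (use inv[of a] hom(1) in \<open>auto dest: inverse_unique\<close>)
  show "\<phi> (a / b) = \<phi> a / \<phi> b" by (simp add: divide_inverse inverse hom)
  show "\<phi> a = \<phi> b \<longleftrightarrow> a = b" using zero[of "a - b"] by (simp add: hom)
qed

lemma is_ring_hom_comp: "is_ring_hom f \<Longrightarrow> is_ring_hom g \<Longrightarrow> is_ring_hom (f \<circ> g)"
  by (auto simp: is_ring_hom_def)

lemma is_ring_hom_map_poly:
  assumes "is_ring_hom f"
  shows "is_ring_hom (map_poly f)"
  unfolding is_ring_hom_def
  by (auto simp: poly_eq_iff coeff_map_poly coeff_mult is_ring_hom_simps[OF assms] is_ring_hom_sum[OF assms])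

lemma is_ring_hom_poly: "is_ring_hom (\<lambda>p. poly p z)"
  by (auto simp: is_ring_hom_def)

lemma is_ring_hom_poly_map_poly:
  assumes "is_ring_hom f"
  shows "is_ring_hom (\<lambda>p. poly (map_poly f p) z)"
  using is_ring_hom_comp[OF is_ring_hom_poly is_ring_hom_map_poly[OF assms]] by (simp add: comp_def)

lemma is_ring_hom_eval2:
  assumes "is_ring_hom f"
  shows "is_ring_hom (eval2 f x y)"
  unfolding eval2_def by (intro is_ring_hom_poly_map_poly assms)

lemma poly_map_poly_hom:
  assumes "is_ring_hom \<phi>"
  shows "poly (map_poly \<phi> p) (\<phi> a) = \<phi> (poly p a)"
  by (induction p) (auto simp: is_ring_hom_simps[OF assms] map_poly_pCons)

lemma eval2_simps:
  assumes "is_ring_hom f"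
  shows "eval2 f x y 0 = 0" "eval2 f x y 1 = 1" "eval2 f x y (P + Q) = eval2 f x y P + eval2 f x y Q"
    "eval2 f x y (P * Q) = eval2 f x y P * eval2 f x y Q"
    "eval2 f x y (P - Q) = eval2 f x y P - eval2 f x y Q"
    "eval2 f x y (- P) = - eval2 f x y P"
    "eval2 f x y (P ^ n) = eval2 f x y P ^ n"
    "eval2 f x y (pCons c P) = poly (map_poly f c) x + y * eval2 f x y P"
    "eval2 f x y (monom c n) = poly (map_poly f c) x * y ^ n"
  using is_ring_hom_simps[OF is_ring_hom_eval2[OF assms, of x y]]
    is_ring_hom_simps[OF is_ring_hom_poly_map_poly[OF assms, of x]]
  by (auto simp: eval2_def map_poly_pCons map_poly_monom poly_monom is_ring_hom_simps[OF assms])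

lemma is_subfield_field_adjoin: "is_subfield (field_adjoin \<iota> A)"
  unfolding field_adjoin_def is_subfield_def by blast

lemma field_adjoin_base: "\<iota> c \<in> field_adjoin \<iota> A"
  and field_adjoin_gen: "a \<in> A \<Longrightarrow> a \<in> field_adjoin \<iota> A"
  unfolding field_adjoin_def by auto

lemma field_adjoin_minimal:
  "is_subfield S \<Longrightarrow> range \<iota> \<subseteq> S \<Longrightarrow> A \<subseteq> S \<Longrightarrow> field_adjoin \<iota> A \<subseteq> S"
  unfolding field_adjoin_def by auto

lemma is_subfieldD:
  assumes "is_subfield S"
  shows "0 \<in> S" "1 \<in> S" "a \<in> S \<Longrightarrow> b \<in> S \<Longrightarrow> a + b \<in> S" "a \<in> S \<Longrightarrow> b \<in> S \<Longrightarrow> a - b \<in> S"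
    "a \<in> S \<Longrightarrow> b \<in> S \<Longrightarrow> a * b \<in> S" "a \<in> S \<Longrightarrow> - a \<in> S" "a \<in> S \<Longrightarrow> inverse a \<in> S"
    "a \<in> S \<Longrightarrow> b \<in> S \<Longrightarrow> a / b \<in> S" "a \<in> S \<Longrightarrow> a ^ n \<in> S"
proof -
  note S = assms[unfolded is_subfield_def]
  show "- a \<in> S" if "a \<in> S" using S that by (metis diff_0)
  show "a / b \<in> S" if "a \<in> S" "b \<in> S" using S that by (simp add: divide_inverse)
  show "a ^ n \<in> S" if "a \<in> S" using S that by (induction n) auto
qed (use assms[unfolded is_subfield_def] in auto)

lemma is_subfield_equalizer:
  fixes \<phi> \<psi> :: "'a::field \<Rightarrow> 'b::field"
  assumes "is_ring_hom \<phi>" "is_ring_hom \<psi>"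
  shows "is_subfield {a. \<phi> a = \<psi> a}"
  unfolding is_subfield_def
  by (auto simp: is_ring_hom_simps[OF assms(1)] is_ring_hom_simps[OF assms(2)]
      is_ring_hom_field_simps[OF assms(1)] is_ring_hom_field_simps[OF assms(2)])

lemma hom_eq_on_field_adjoin:
  fixes \<phi> \<psi> :: "'a::field \<Rightarrow> 'b::field"
  assumes "is_ring_hom \<phi>" "is_ring_hom \<psi>" "\<And>c. \<phi> (\<iota> c) = \<psi> (\<iota> c)" "\<And>a. a \<in> A \<Longrightarrow> \<phi> a = \<psi> a"
    and "f \<in> field_adjoin \<iota> A"
  shows "\<phi> f = \<psi> f"
  using field_adjoin_minimal[OF is_subfield_equalizer[OF assms(1,2)], of \<iota> A] assms by auto

section \<open>Polynomials over a subfield and simple algebraic extensions\<close>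

definition coeffs_in :: "'a::field set \<Rightarrow> 'a poly \<Rightarrow> bool" where
  "coeffs_in k p \<longleftrightarrow> (\<forall>i. coeff p i \<in> k)"

lemma coeffs_in_intros:
  assumes "is_subfield k"
  shows "coeffs_in k 0" "coeffs_in k 1" "c \<in> k \<Longrightarrow> coeffs_in k [:c:]" "c \<in> k \<Longrightarrow> coeffs_in k (monom c n)"
    "coeffs_in k p \<Longrightarrow> coeffs_in k r \<Longrightarrow> coeffs_in k (p + r)"
    "coeffs_in k p \<Longrightarrow> coeffs_in k r \<Longrightarrow> coeffs_in k (p - r)"
    "coeffs_in k p \<Longrightarrow> coeffs_in k r \<Longrightarrow> coeffs_in k (p * r)"
    "coeffs_in k p \<Longrightarrow> c \<in> k \<Longrightarrow> coeffs_in k (pCons c p)"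
    "coeffs_in k p \<Longrightarrow> coeffs_in k (- p)"
    "coeffs_in k p \<Longrightarrow> coeffs_in k (p ^ n)"
proof -
  note k = is_subfieldD[OF assms]
  have sum: "sum f A \<in> k" if "\<And>i. i \<in> A \<Longrightarrow> f i \<in> k" for f and A :: "nat set"
    using that by (induction A rule: infinite_finite_induct) (auto intro: k)
  show one: "coeffs_in k 1" by (auto simp: coeffs_in_def k)
  show mult: "coeffs_in k (p * r)" if "coeffs_in k p" "coeffs_in k r" for p r
    using that by (auto simp: coeffs_in_def coeff_mult intro!: sum k)
  show "coeffs_in k (p ^ n)" if "coeffs_in k p"
    using that by (induction n) (auto intro: one mult)
qed (auto simp: coeffs_in_def coeff_pCons is_subfieldD[OF assms] split: nat.splits)

lemma poly_in_subfield:
  assumes "is_subfield T" "a \<in> T" "coeffs_in T p"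
  shows "poly p a \<in> T"
  using assms(3)
proof (induction p)
  case (pCons c p)
  have "c \<in> T" using pCons.prems[unfolded coeffs_in_def, rule_format, of 0] by simp
  moreover have "coeffs_in T p"
    unfolding coeffs_in_def using pCons.prems[unfolded coeffs_in_def, rule_format, of "Suc _"] by simp
  ultimately show ?case using pCons.IH assms(2) is_subfieldD[OF assms(1)] by auto
qed (use is_subfieldD[OF assms(1)] in auto)

text \<open>Here \<open>k\<close> is a subset of the type, so quotient and remainder must be seen to
  stay over \<open>k\<close>: each step cancels the leading term by \<open>m\<close>, whose
  coefficient is a quotient of two elements of \<open>k\<close>.\<close>

lemma coeffs_in_division:
  assumes k: "is_subfield k" and g: "coeffs_in k g" "g \<noteq> 0" and "coeffs_in k p"
  shows "\<exists>h r. coeffs_in k h \<and> coeffs_in k r \<and> p = g * h + r \<and> (r = 0 \<or> degree r < degree g)"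
  using assms(4)
proof (induction "degree p" arbitrary: p rule: less_induct)
  case less
  show ?case
  proof (cases "p = 0 \<or> degree p < degree g")
    case True
    then show ?thesis using less.prems coeffs_in_intros[OF k] by (intro exI[of _ 0] exI[of _ p]) auto
  next
    case False
    define m where "m = monom (lead_coeff p / lead_coeff g) (degree p - degree g)"
    have "coeffs_in k m" unfolding m_def using less.prems g(1)
      by (intro coeffs_in_intros is_subfieldD k) (auto simp: coeffs_in_def)
    then have p': "coeffs_in k (p - g * m)"
      using g less.prems by (intro coeffs_in_intros k)
    have "m \<noteq> 0" "degree m = degree p - degree g" "lead_coeff m = lead_coeff p / lead_coeff g"
      using g False by (auto simp: m_def degree_monom_eq monom_eq_0_iff)
    then have "lead_coeff (g * m) = lead_coeff p" "degree (g * m) = degree p"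
      using g False by (simp_all only: lead_coeff_mult) (auto simp: degree_mult_eq)
    then have "p - g * m = 0 \<or> degree (p - g * m) < degree p"
      by (metis coeff_diff degree_diff_le degree_0 diff_self leading_coeff_0_iff nat_less_le order.refl)
    then obtain h r where hr: "coeffs_in k h" "coeffs_in k r" "p - g * m = g * h + r" "r = 0 \<or> degree r < degree g"
      using less.hyps[OF _ p'] coeffs_in_intros(1)[OF k] by (metis add.right_neutral mult_zero_right)
    then show ?thesis using \<open>coeffs_in k m\<close> coeffs_in_intros(5)[OF k]
      by (intro exI[of _ "h + m"] exI[of _ r]) (auto simp: algebra_simps)
  qed
qed

text \<open>This is the ring k[\<alpha>]. It is the field k(\<alpha>) once \<alpha> is algebraic
  over \<open>k\<close>.\<close>

definition simple_ext :: "'a::field set \<Rightarrow> 'a \<Rightarrow> 'a set" where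
  "simple_ext k \<alpha> = {poly p \<alpha> |p. coeffs_in k p}"

lemma simple_ext_small_degree:
  assumes k: "is_subfield k" and m: "coeffs_in k m" "m \<noteq> 0" "poly m \<alpha> = 0" and f: "f \<in> simple_ext k \<alpha>"
  obtains r where "coeffs_in k r" "f = poly r \<alpha>" "degree r < degree m"
proof -
  have "degree m > 0" using m by (metis bot_nat_0.not_eq_extremum degree_eq_zeroE mult_zero_right
        pCons_0_0 poly_0 poly_pCons add.right_neutral)
  from f obtain p where p: "coeffs_in k p" "f = poly p \<alpha>" by (auto simp: simple_ext_def)
  obtain h r where "coeffs_in k r" "p = m * h + r" "r = 0 \<or> degree r < degree m"
    using coeffs_in_division[OF k m(1,2) p(1)] by blast
  then show ?thesis using that[of r] p m \<open>degree m > 0\<close> by auto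
qed

text \<open>Inverses come from descending division: m = g h + r gives 1 / g(\<alpha>) = -
  h(\<alpha>) / r(\<alpha>), where r has smaller degree than g, until g is constant. The given
  polynomial is replaced by one of least degree that vanishes at \<alpha>; this guarantees
  h(\<alpha>) \<noteq> 0 and hence r(\<alpha>) \<noteq> 0.\<close>

lemma is_subfield_simple_ext:
  assumes k: "is_subfield k" and "coeffs_in k m" "m \<noteq> 0" "poly m \<alpha> = 0"
  shows "is_subfield (simple_ext k \<alpha>)"
proof -
  define P where "P p \<longleftrightarrow> coeffs_in k p \<and> p \<noteq> 0 \<and> poly p \<alpha> = 0" for p
  define m where "m = arg_min degree P"
  have "P m" and min: "\<And>p. P p \<Longrightarrow> degree m \<le> degree p"
    using assms(2-4) arg_min_nat_lemma[of P _ degree] unfolding m_def P_def by blast+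
  then have m: "coeffs_in k m" "m \<noteq> 0" "poly m \<alpha> = 0" by (auto simp: P_def)
  note I = coeffs_in_intros[OF k]
  have mem: "poly p \<alpha> \<in> simple_ext k \<alpha>" if "coeffs_in k p" for p
    using that by (auto simp: simple_ext_def)
  have inv: "inverse (poly g \<alpha>) \<in> simple_ext k \<alpha>"
    if "coeffs_in k g" "poly g \<alpha> \<noteq> 0" "degree g < degree m" for g
    using that
  proof (induction "degree g" arbitrary: g rule: less_induct)
    case less
    show ?case
    proof (cases "degree g = 0")
      case True
      then obtain c where "g = [:c:]" by (metis degree_eq_zeroE)
      then have "poly [:inverse c:] \<alpha> = inverse (poly g \<alpha>)" "c \<in> k"
        using less.prems by (auto simp: coeffs_in_def coeff_pCons split: nat.splits)
      then show ?thesis using mem[of "[:inverse c:]"] I(3) is_subfieldD(7)[OF k] by metis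
    next
      case False
      have "g \<noteq> 0" using False by auto
      obtain h r where hr: "coeffs_in k h" "coeffs_in k r" "m = g * h + r" "r = 0 \<or> degree r < degree g"
        using coeffs_in_division[OF k less.prems(1) \<open>g \<noteq> 0\<close> m(1)] by blast
      have rh: "poly r \<alpha> = - (poly g \<alpha> * poly h \<alpha>)"
        using m(3) hr(3) by (simp add: add_eq_0_iff)
      have "h \<noteq> 0" using hr less.prems(3) m(2) by auto
      have "degree m = degree g + degree h"
        using hr \<open>g \<noteq> 0\<close> \<open>h \<noteq> 0\<close> by (metis add.right_neutral degree_add_eq_left degree_mult_eq
            trans_less_add1)
      then have "poly h \<alpha> \<noteq> 0" using min[of h] False hr(1) \<open>h \<noteq> 0\<close> by (auto simp: P_def)
      then have "poly r \<alpha> \<noteq> 0" using rh less.prems(2) by simp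
      moreover have "degree r < degree g" using hr \<open>poly r \<alpha> \<noteq> 0\<close> by auto
      ultimately have "inverse (poly r \<alpha>) \<in> simple_ext k \<alpha>"
        using less.hyps[of r] hr less.prems by auto
      then obtain e where e: "coeffs_in k e" "poly e \<alpha> = inverse (poly r \<alpha>)"
        by (auto simp: simple_ext_def)
      have "inverse (poly g \<alpha>) = poly (- h * e) \<alpha>"
        using e rh \<open>poly h \<alpha> \<noteq> 0\<close> less.prems(2) by (simp add: field_simps)
      then show ?thesis using mem[of "- h * e"] I(7,9) e hr by metis
    qed
  qed
  have "inverse f \<in> simple_ext k \<alpha>" if "f \<in> simple_ext k \<alpha>" for f
  proof (cases "f = 0")
    case True
    then show ?thesis using mem[of 0] I(1) by simp
  next
    case False
    then show ?thesis using simple_ext_small_degree[OF k m that] inv by metis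
  qed
  moreover have "0 \<in> simple_ext k \<alpha>" "1 \<in> simple_ext k \<alpha>" using mem[OF I(1)] mem[OF I(2)] by auto
  moreover have "a + b \<in> simple_ext k \<alpha>" "a - b \<in> simple_ext k \<alpha>" "a * b \<in> simple_ext k \<alpha>"
    if ab: "a \<in> simple_ext k \<alpha>" "b \<in> simple_ext k \<alpha>" for a b
  proof -
    from ab obtain p r where "coeffs_in k p" "a = poly p \<alpha>" "coeffs_in k r" "b = poly r \<alpha>"
      by (auto simp: simple_ext_def)
    then show "a + b \<in> simple_ext k \<alpha>" "a - b \<in> simple_ext k \<alpha>" "a * b \<in> simple_ext k \<alpha>"
      using mem[OF I(5), of p r] mem[OF I(6), of p r] mem[OF I(7), of p r] by auto
  qed
  ultimately show ?thesis by (auto simp: is_subfield_def)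
qed

lemma simple_ext_contains:
  assumes k: "is_subfield k"
  shows "k \<subseteq> simple_ext k \<alpha>" "\<alpha> \<in> simple_ext k \<alpha>"
proof -
  show "k \<subseteq> simple_ext k \<alpha>"
  proof
    fix c assume "c \<in> k"
    then show "c \<in> simple_ext k \<alpha>"
      using coeffs_in_intros(3)[OF k] by (force simp: simple_ext_def intro!: exI[of _ "[:c:]"])
  qed
  have "coeffs_in k [:0, 1:]" using coeffs_in_intros[OF k] is_subfieldD[OF k] by simp
  then show "\<alpha> \<in> simple_ext k \<alpha>" by (force simp: simple_ext_def intro!: exI[of _ "[:0, 1:]"])
qed

text \<open>Artin's argument as a root count. Write f = r(\<alpha>) with r of smaller degree than m.
  Every \<sigma> in S fixes the coefficients of r - f, so this polynomial vanishes at all the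
  \<sigma> \<alpha>. There are too many of them unless r is the constant f.\<close>

lemma fixed_in_base_field:
  assumes k: "is_subfield k" and m: "coeffs_in k m" "m \<noteq> 0" "poly m \<alpha> = 0"
    and S: "\<And>\<sigma>. \<sigma> \<in> S \<Longrightarrow> is_ring_hom \<sigma>" "\<And>\<sigma> c. \<sigma> \<in> S \<Longrightarrow> c \<in> k \<Longrightarrow> \<sigma> c = c"
    and card: "degree m \<le> card ((\<lambda>\<sigma>. \<sigma> \<alpha>) ` S)"
    and f: "f \<in> simple_ext k \<alpha>" "\<And>\<sigma>. \<sigma> \<in> S \<Longrightarrow> \<sigma> f = f"
  shows "f \<in> k"
proof -
  obtain r where r: "coeffs_in k r" "f = poly r \<alpha>" "degree r < degree m"
    using simple_ext_small_degree[OF k m f(1)] .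
  define g where "g = r - [:f:]"
  have deg: "degree g < degree m" using r(3) unfolding g_def by (intro degree_diff_less) auto
  have "poly g (\<sigma> \<alpha>) = 0" if "\<sigma> \<in> S" for \<sigma>
  proof -
    have "map_poly \<sigma> g = g"
      using S(2)[OF that] f(2)[OF that] r(1) is_ring_hom_simps[OF S(1)[OF that]]
      by (auto simp: poly_eq_iff coeff_map_poly g_def coeffs_in_def coeff_pCons split: nat.splits)
    then show ?thesis
      using poly_map_poly_hom[OF S(1)[OF that], of g \<alpha>] is_ring_hom_simps[OF S(1)[OF that]]
      by (simp add: g_def r(2))
  qed
  then have sub: "(\<lambda>\<sigma>. \<sigma> \<alpha>) ` S \<subseteq> {z. poly g z = 0}" by auto
  have "g = 0"
  proof (rule ccontr)
    assume "g \<noteq> 0"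
    then have "card ((\<lambda>\<sigma>. \<sigma> \<alpha>) ` S) \<le> degree g"
      using card_mono[OF poly_roots_finite sub] card_poly_roots_bound by fastforce
    then show False using card deg by simp
  qed
  then have "r = [:f:]" by (simp add: g_def)
  then show ?thesis using r(1) by (auto simp: coeffs_in_def dest: spec[of _ 0])
qed

text \<open>Splitting off X - a leaves a factor g with g(a) = f'(a) \<noteq> 0, so the root a is not
  counted again.\<close>

lemma card_roots_separable:
  fixes f :: "'k::alg_closed_field poly"
  assumes "f \<noteq> 0" "\<And>a. poly f a = 0 \<Longrightarrow> poly (pderiv f) a \<noteq> 0"
  shows "card {a. poly f a = 0} = degree f"
  using assms
proof (induction "degree f" arbitrary: f)
  case 0
  then obtain c where "f = [:c:]" by (metis degree_eq_zeroE)
  then show ?case using 0 by auto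
next
  case (Suc n)
  then obtain a where "poly f a = 0" using alg_closed_imp_poly_has_root[of f] by auto
  then obtain g where g: "f = [:-a, 1:] * g" by (auto simp: poly_eq_0_iff_dvd)
  have "g \<noteq> 0" using g Suc by auto
  then have deg: "degree f = Suc (degree g)" unfolding g by (subst degree_mult_eq) auto
  have d: "poly (pderiv f) c = poly g c + (c - a) * poly (pderiv g) c" for c
    unfolding g pderiv_mult by (simp add: pderiv_pCons algebra_simps)
  have ga: "poly g a \<noteq> 0" using d[of a] Suc.prems(2)[of a] \<open>poly f a = 0\<close> by simp
  have "card {a. poly g a = 0} = degree g"
  proof (rule Suc.hyps(1))
    show "poly (pderiv g) c \<noteq> 0" if "poly g c = 0" for c
      using Suc.prems(2)[of c] d[of c] that g by auto
  qed (use deg Suc.hyps \<open>g \<noteq> 0\<close> in auto)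
  moreover have "{c. poly f c = 0} = insert a {c. poly g c = 0}" unfolding g by auto
  ultimately show ?case using ga deg poly_roots_finite[OF \<open>g \<noteq> 0\<close>] by simp
qed

section \<open>The Hermitian function field\<close>

lemma CHAR_hom:
  fixes \<iota> :: "'k::field \<Rightarrow> 'f::field"
  assumes "is_ring_hom \<iota>"
  shows "CHAR('f) = CHAR('k)"
proof -
  have "\<iota> (of_nat n) = of_nat n" for n
    by (induction n) (auto simp: is_ring_hom_simps[OF assms])
  then have "CHAR('f) dvd n \<longleftrightarrow> CHAR('k) dvd n" for n
    using is_ring_hom_field_simps(1)[OF assms, of "of_nat n"]
    by (simp flip: of_nat_eq_0_iff_char_dvd)
  then show ?thesis by (meson dvd_antisym dvd_refl)
qed

lemma frobenius_power:
  fixes a b :: "'a::comm_ring_1"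
  assumes "prime CHAR('a)" "m = CHAR('a) ^ n"
  shows "(a + b) ^ m = a ^ m + b ^ m" "(a - b) ^ m = a ^ m - b ^ m" "(- a) ^ m = - (a ^ m)"
proof -
  show add: "(a + b) ^ m = a ^ m + b ^ m" for a b :: 'a by (rule freshmans_dream'[OF assms])
  have "m > 0" using assms by (simp add: prime_gt_0_nat)
  show uminus: "(- a) ^ m = - (a ^ m)" for a :: 'a
    using add[of a "- a"] \<open>m > 0\<close> by (simp add: power_0_left eq_neg_iff_add_eq_0 add.commute)
  show "(a - b) ^ m = a ^ m - b ^ m" using add[of a "- b"] uminus by simp
qed

text \<open>An element outside an algebraically closed field is transcendental over it:
  \<open>d\<close> splits into linear factors, and no factor z - a vanishes.\<close>

lemma poly_map_poly_eq_0_alg_closed: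
  fixes \<iota> :: "'k::alg_closed_field \<Rightarrow> 'f::field"
  assumes "is_ring_hom \<iota>" "z \<notin> range \<iota>" "poly (map_poly \<iota> d) z = 0"
  shows "d = 0"
  using assms(3)
proof (induction "degree d" arbitrary: d)
  case 0
  then obtain c where "d = [:c:]" by (metis degree_eq_zeroE)
  then show ?case using 0 is_ring_hom_field_simps(1)[OF assms(1)]
    by (auto simp: map_poly_pCons is_ring_hom_simps[OF assms(1)])
next
  case (Suc n)
  then obtain a where "poly d a = 0" using alg_closed_imp_poly_has_root[of d] by auto
  then obtain g where g: "d = [:-a, 1:] * g" by (auto simp: poly_eq_0_iff_dvd)
  have "g \<noteq> 0" using g Suc by auto
  then have "degree d = Suc (degree g)" unfolding g by (subst degree_mult_eq) auto
  moreover have "poly (map_poly \<iota> d) z = (z - \<iota> a) * poly (map_poly \<iota> g) z"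
    unfolding g is_ring_hom_simps[OF is_ring_hom_poly_map_poly[OF assms(1)]]
    by (simp add: map_poly_pCons is_ring_hom_simps[OF assms(1)])
  ultimately have "g = 0" using Suc assms(2) by auto
  then show ?case using g by simp
qed

locale hermitian =
  fixes p h q :: nat and \<iota> :: "'k::alg_closed_field \<Rightarrow> 'f::field" and x y :: 'f
  assumes prime_p: "prime p" and h: "h \<ge> 1" and q_def: "q = p ^ h" and q_neq_2: "q \<noteq> 2"
    and char_k: "CHAR('k) = p"
    and function_field: "hermitian_function_field q \<iota> x y"
begin

lemma q_ge_3: "q \<ge> 3"
proof -
  have "p ^ 1 \<le> p ^ h" using h prime_gt_0_nat[OF prime_p] by (intro power_increasing) auto
  then show ?thesis using prime_ge_2_nat[OF prime_p] q_neq_2 q_def by simp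
qed

lemma hom: "is_ring_hom \<iota>"
  using function_field by (simp add: hermitian_function_field_def)

lemmas \<iota>_simps [simp] = is_ring_hom_simps[OF hom] is_ring_hom_field_simps[OF hom]

lemma char_f: "CHAR('f) = p"
  using CHAR_hom[OF hom] char_k by simp

lemma frob_k:
  fixes a b :: 'k
  shows "(a + b) ^ (q ^ n) = a ^ (q ^ n) + b ^ (q ^ n)"
    "(a - b) ^ (q ^ n) = a ^ (q ^ n) - b ^ (q ^ n)" "(- a) ^ (q ^ n) = - (a ^ (q ^ n))"
  using frobenius_power[where 'a = 'k, of "q ^ n" "h * n"] prime_p
  by (simp_all add: char_k q_def power_mult)

lemma frob_f:
  fixes a b :: 'f
  shows "(a + b) ^ (q ^ n) = a ^ (q ^ n) + b ^ (q ^ n)"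
    "(a - b) ^ (q ^ n) = a ^ (q ^ n) - b ^ (q ^ n)" "(- a) ^ (q ^ n) = - (a ^ (q ^ n))"
  using frobenius_power[where 'a = 'f, of "q ^ n" "h * n"] prime_p
  by (simp_all add: char_f q_def power_mult)

lemmas frob1_k = frob_k(1,2)[of _ _ 1, unfolded power_one_right] frob_k(3)[of _ 1, unfolded power_one_right]
lemmas frob1_f = frob_f(1,2)[of _ _ 1, unfolded power_one_right] frob_f(3)[of _ 1, unfolded power_one_right]

lemma eval2_hermitian_poly:
  assumes "is_ring_hom f"
  shows "eval2 f X Y (hermitian_poly q) = Y ^ q + Y - X ^ (q + 1)"
  by (simp add: hermitian_poly_def eval2_simps[OF assms] map_poly_monom poly_monom
      is_ring_hom_simps[OF assms] map_poly_pCons one_pCons)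

lemma kernel: "eval2 \<iota> x y P = 0 \<longleftrightarrow> hermitian_poly q dvd P"
  using function_field by (simp add: hermitian_function_field_def)

lemma generated: "field_adjoin \<iota> {x, y} = UNIV"
  using function_field by (simp add: hermitian_function_field_def)

lemma curve: "y ^ q + y = x ^ (q + 1)"
  using kernel[of "hermitian_poly q"] eval2_hermitian_poly[OF hom, of x y] by simp

lemma degree_hermitian_poly: "degree (hermitian_poly q :: 'k poly poly) = q"
  unfolding hermitian_poly_def diff_conv_add_uminus add.assoc using q_ge_3
  by (subst degree_add_eq_left)
     (auto simp: degree_monom_eq intro!: degree_add_less le_less_trans[OF degree_monom_le])

text \<open>The kernel of evaluation is generated by a polynomial of degree \<open>q\<close> in Y.
  So 1, y, ..., y^(q-1) are linearly independent over K[x].\<close>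

lemma eval2_eq_0_small_degree:
  assumes "eval2 \<iota> x y P = 0" "degree P < q"
  shows "P = 0"
  using assms dvd_imp_degree_le[of "hermitian_poly q" P] degree_hermitian_poly kernel by fastforce

section \<open>Fractions in x and a normal form for the elements of the function field\<close>

abbreviation px :: "'k poly \<Rightarrow> 'f" where "px d \<equiv> poly (map_poly \<iota> d) x"

lemmas px_simps = is_ring_hom_simps[OF is_ring_hom_poly_map_poly[OF hom, of x]]

lemmas ev_simps = eval2_simps[OF hom, of x y]

lemma eval2_const: "eval2 \<iota> x y [:d:] = px d"
  by (simp add: eval2_simps[OF hom])

lemma px_eq_0_iff: "px d = 0 \<longleftrightarrow> d = 0"
  using eval2_eq_0_small_degree[of "[:d:]"] q_ge_3 px_simps(1) by (auto simp: eval2_const)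

lemma x_not_const: "x \<noteq> \<iota> c"
  using px_eq_0_iff[of "[:-c, 1:]"] by (auto simp: map_poly_pCons)

lemma y_not_const: "y \<noteq> \<iota> c"
  using eval2_eq_0_small_degree[of "[:[:-c:], 1:]"] q_ge_3
  by (auto simp: ev_simps map_poly_pCons)

lemma x_neq_0: "x \<noteq> 0" using x_not_const[of 0] by simp
lemma y_neq_0: "y \<noteq> 0" using y_not_const[of 0] by simp

lemma is_subfield_px: "is_subfield {px n / px d |n d. d \<noteq> 0}" (is "is_subfield ?S")
proof -
  have mem: "px n / px d \<in> ?S" if "d \<noteq> 0" for n d using that by blast
  have "0 \<in> ?S" "1 \<in> ?S" using mem[of 1 0] mem[of 1 1] by (simp_all add: px_simps)
  moreover have "a + b \<in> ?S" "a - b \<in> ?S" "a * b \<in> ?S" if "a \<in> ?S" "b \<in> ?S" for a b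
  proof -
    from that obtain n d n' d' where ab: "a = px n / px d" "b = px n' / px d'" "d \<noteq> 0" "d' \<noteq> 0" by blast
    have "a + b = px (n * d' + n' * d) / px (d * d')" "a - b = px (n * d' - n' * d) / px (d * d')"
      "a * b = px (n * n') / px (d * d')"
      unfolding px_simps ab(1,2) using ab(3,4) px_eq_0_iff
      by (simp_all add: add_frac_eq diff_frac_eq)
    then show "a + b \<in> ?S" "a - b \<in> ?S" "a * b \<in> ?S" using mem[of "d * d'"] ab by auto
  qed
  moreover have "inverse a \<in> ?S" if "a \<in> ?S" for a
  proof -
    from that obtain n d where a: "a = px n / px d" "d \<noteq> 0" by blast
    show ?thesis
    proof (cases "n = 0")
      case True
      then show ?thesis using a \<open>0 \<in> ?S\<close> by (simp add: px_simps)
    next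
      case False
      then show ?thesis using mem[of n d] a by simp
    qed
  qed
  ultimately show ?thesis unfolding is_subfield_def by (intro conjI ballI)
qed

lemma field_adjoin_x: "field_adjoin \<iota> {x} = {px n / px d |n d. d \<noteq> 0}"
proof
  show "field_adjoin \<iota> {x} \<subseteq> {px n / px d |n d. d \<noteq> 0}"
  proof (rule field_adjoin_minimal[OF is_subfield_px])
    have "\<iota> c = px [:c:] / px 1" for c by (simp add: px_simps map_poly_pCons)
    then show "range \<iota> \<subseteq> {px n / px d |n d. d \<noteq> 0}" using one_neq_zero by blast
    have "x = px [:0, 1:] / px 1" by (simp add: px_simps map_poly_pCons)
    then show "{x} \<subseteq> {px n / px d |n d. d \<noteq> 0}" using one_neq_zero by blast
  qed
  have "px n \<in> field_adjoin \<iota> {x}" for n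
  proof (rule poly_in_subfield[OF is_subfield_field_adjoin])
    show "coeffs_in (field_adjoin \<iota> {x}) (map_poly \<iota> n)"
      using field_adjoin_base[of \<iota>] by (auto simp: coeffs_in_def coeff_map_poly)
  qed (auto intro: field_adjoin_gen)
  then show "{px n / px d |n d. d \<noteq> 0} \<subseteq> field_adjoin \<iota> {x}"
    using is_subfieldD(8)[OF is_subfield_field_adjoin] by blast
qed

lemma y_algebraic:
  defines "m \<equiv> monom 1 q + monom 1 1 - [:x ^ (q + 1):]"
  shows "coeffs_in (field_adjoin \<iota> {x}) m" "degree m = q" "poly m y = 0"
proof -
  have "x \<in> field_adjoin \<iota> {x}" by (simp add: field_adjoin_gen)
  then show "coeffs_in (field_adjoin \<iota> {x}) m"
    unfolding m_def by (intro coeffs_in_intros is_subfieldD is_subfield_field_adjoin)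
  show "degree m = q"
    unfolding m_def diff_conv_add_uminus add.assoc using q_ge_3
    by (subst degree_add_eq_left)
       (auto simp: degree_monom_eq intro!: degree_add_less le_less_trans[OF degree_monom_le])
  show "poly m y = 0" unfolding m_def using curve by (simp add: poly_monom)
qed

lemma simple_ext_y: "simple_ext (field_adjoin \<iota> {x}) y = UNIV"
proof -
  note k = is_subfield_field_adjoin[of \<iota> "{x}"]
  have "is_subfield (simple_ext (field_adjoin \<iota> {x}) y)"
    using is_subfield_simple_ext[OF k y_algebraic(1) _ y_algebraic(3)] y_algebraic(2) q_ge_3
    by (metis degree_0 not_numeral_le_zero)
  then have "field_adjoin \<iota> {x, y} \<subseteq> simple_ext (field_adjoin \<iota> {x}) y"
    using simple_ext_contains[OF k] field_adjoin_base[of \<iota> _ "{x}"] field_adjoin_gen[of x "{x}" \<iota>]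
    by (intro field_adjoin_minimal) auto
  then show ?thesis using generated by auto
qed

text \<open>Zero coefficients of \<open>r\<close> remain zero in \<open>P\<close>, so clearing
  denominators does not raise the degree in y.\<close>

lemma common_denominator:
  assumes "coeffs_in (field_adjoin \<iota> {x}) r"
  shows "\<exists>P d. d \<noteq> 0 \<and> (\<forall>i. coeff r i = 0 \<longrightarrow> coeff P i = 0) \<and> poly r y = eval2 \<iota> x y P / px d"
  using assms
proof (induction r)
  case 0
  then show ?case by (intro exI[of _ 0] exI[of _ 1]) (auto simp: ev_simps)
next
  case (pCons c r)
  have "c \<in> field_adjoin \<iota> {x}" using pCons.prems[unfolded coeffs_in_def, rule_format, of 0] by simp
  then obtain n d' where c: "c = px n / px d'" "d' \<noteq> 0" unfolding field_adjoin_x by blast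
  have "coeffs_in (field_adjoin \<iota> {x}) r"
    unfolding coeffs_in_def using pCons.prems[unfolded coeffs_in_def, rule_format, of "Suc _"] by simp
  then obtain P d where P: "d \<noteq> 0" "\<And>i. coeff r i = 0 \<Longrightarrow> coeff P i = 0" "poly r y = eval2 \<iota> x y P / px d"
    using pCons.IH by blast
  have "eval2 \<iota> x y (smult d' P) = px d' * eval2 \<iota> x y P"
    using ev_simps(4)[of "[:d':]" P] by (simp add: eval2_const)
  then have "poly (pCons c r) y = eval2 \<iota> x y (pCons (n * d) (smult d' P)) / px (d * d')"
    using P(1) c(2) px_eq_0_iff unfolding ev_simps(8) px_simps(4) poly_pCons P(3) c(1)
    by (simp add: add_frac_eq algebra_simps)
  moreover have "coeff (pCons (n * d) (smult d' P)) i = 0" if "coeff (pCons c r) i = 0" for i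
    using that P(2) c px_eq_0_iff by (auto simp: coeff_pCons split: nat.splits)
  ultimately show ?case using P(1) c(2) by (intro exI[of _ "pCons (n * d) (smult d' P)"] exI[of _ "d * d'"]) auto
qed

text \<open>The field is K(x)[y], so a denominator in x alone suffices, and reduction by the curve
  equation keeps the numerator where the powers of y are independent.\<close>

lemma fraction:
  obtains P d where "d \<noteq> 0" "degree P < q" "f = eval2 \<iota> x y P / px d"
proof -
  have "f \<in> simple_ext (field_adjoin \<iota> {x}) y" using simple_ext_y by simp
  then obtain r where r: "coeffs_in (field_adjoin \<iota> {x}) r" "f = poly r y" "degree r < q"
    using simple_ext_small_degree[OF is_subfield_field_adjoin y_algebraic(1) _ y_algebraic(3), of f]
      y_algebraic(2) q_ge_3 by (metis degree_0 not_numeral_le_zero)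
  then obtain P d where P: "d \<noteq> 0" "\<And>i. coeff r i = 0 \<Longrightarrow> coeff P i = 0" "f = eval2 \<iota> x y P / px d"
    using common_denominator by blast
  have "coeff P i = 0" if "q \<le> i" for i using r(3) that by (intro P(2) coeff_eq_0) simp
  then have "degree P < q" using q_ge_3 by (intro degree_lessI) auto
  then show ?thesis using that P by blast
qed

text \<open>The map sends a fraction in (x, y) to the same fraction in (X, Y). Numerators may be
  substituted because (X, Y) satisfies the generator of the kernel. Denominators, being polynomials
  in x alone, stay nonzero because X is not a constant and hence is transcendental. The relation
  \<open>R\<close> collects all representations, so that independence of the representation is its
  functionality.\<close>

lemma hom_extension:
  assumes XY: "Y ^ q + Y = X ^ (q + 1)" and X: "X \<notin> range \<iota>"
  shows "\<exists>\<phi>. is_ring_hom \<phi> \<and> (\<forall>c. \<phi> (\<iota> c) = \<iota> c) \<and> \<phi> x = X \<and> \<phi> y = Y"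
proof -
  let ?pX = "\<lambda>d. poly (map_poly \<iota> d) X"
  note pX = is_ring_hom_simps[OF is_ring_hom_poly_map_poly[OF hom, of X]]
  note eX = eval2_simps[OF hom, of X Y]
  have eval2_const_X: "eval2 \<iota> X Y [:d:] = ?pX d" for d by (simp add: eX(1,8))
  have pX0: "?pX d = 0 \<longleftrightarrow> d = 0" for d
    using poly_map_poly_eq_0_alg_closed[OF hom X, of d] pX(1) by (cases "d = 0") auto
  have ker: "eval2 \<iota> X Y P = 0" if zero: "eval2 \<iota> x y P = 0" for P
  proof -
    obtain R where "P = hermitian_poly q * R" using zero kernel by (auto elim: dvdE)
    then show ?thesis using eval2_hermitian_poly[OF hom, of X Y] XY by (simp add: eX)
  qed
  define R where "R f g \<longleftrightarrow> (\<exists>P d. d \<noteq> 0 \<and> f = eval2 \<iota> x y P / px d \<and> g = eval2 \<iota> X Y P / ?pX d)" for f g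
  have R_unique: "g = g'" if Rfg: "R f g" "R f g'" for f g g'
  proof -
    from Rfg obtain P d P' d' where *: "d \<noteq> 0" "f = eval2 \<iota> x y P / px d" "g = eval2 \<iota> X Y P / ?pX d"
      "d' \<noteq> 0" "f = eval2 \<iota> x y P' / px d'" "g' = eval2 \<iota> X Y P' / ?pX d'"
      unfolding R_def by blast
    have "eval2 \<iota> x y P / px d = eval2 \<iota> x y P' / px d'" using *(2,5) by simp
    then have "eval2 \<iota> x y P * px d' = eval2 \<iota> x y P' * px d"
      using *(1,4) px_eq_0_iff by (simp add: frac_eq_eq)
    then have "eval2 \<iota> x y (P * [:d':] - P' * [:d:]) = 0"
      unfolding ev_simps(4,5) eval2_const by simp
    from ker[OF this] have "eval2 \<iota> X Y P * ?pX d' = eval2 \<iota> X Y P' * ?pX d"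
      unfolding eX(4,5) eval2_const_X by simp
    then show ?thesis unfolding *(3,6) using *(1,4) pX0 by (simp add: frac_eq_eq)
  qed
  have R_total: "\<exists>g. R f g" for f using fraction[of f] unfolding R_def by metis
  have R1: "R (eval2 \<iota> x y P) (eval2 \<iota> X Y P)" for P
    unfolding R_def by (intro exI[of _ P] exI[of _ 1]) (simp add: px_simps pX)
  have R_add: "R (f + f') (g + g')" and R_mult: "R (f * f') (g * g')" if Rfg: "R f g" "R f' g'" for f g f' g'
  proof -
    from Rfg obtain P d P' d' where *: "d \<noteq> 0" "f = eval2 \<iota> x y P / px d" "g = eval2 \<iota> X Y P / ?pX d"
      "d' \<noteq> 0" "f' = eval2 \<iota> x y P' / px d'" "g' = eval2 \<iota> X Y P' / ?pX d'"
      unfolding R_def by blast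
    show "R (f + f') (g + g')" unfolding R_def
      unfolding *(2,3,5,6) using *(1,4) px_eq_0_iff pX0
      by (intro exI[of _ "P * [:d':] + P' * [:d:]"] exI[of _ "d * d'"])
         (simp only: ev_simps(3,4) eX(3,4) eval2_const eval2_const_X px_simps(4) pX(4) add_frac_eq mult_eq_0_iff
           de_Morgan_disj simp_thms)
    show "R (f * f') (g * g')" unfolding R_def
      using * by (intro exI[of _ "P * P'"] exI[of _ "d * d'"]) (simp add: ev_simps(4) eX(4) px_simps(4) pX(4))
  qed
  define \<phi> where "\<phi> f = (THE g. R f g)" for f
  have \<phi>: "\<phi> f = g" if "R f g" for f g
    unfolding \<phi>_def using that R_unique by (intro the_equality) blast+
  have R\<phi>: "R f (\<phi> f)" for f using R_total \<phi> by metis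
  have "is_ring_hom \<phi>" unfolding is_ring_hom_def
    using \<phi>[OF R1[of 1]] \<phi>[OF R_add[OF R\<phi> R\<phi>]] \<phi>[OF R_mult[OF R\<phi> R\<phi>]] by (simp add: ev_simps eX)
  moreover have "\<phi> (\<iota> c) = \<iota> c" for c using \<phi>[OF R1[of "[:[:c:]:]"]]
    by (simp add: ev_simps eX map_poly_pCons)
  moreover have "\<phi> x = X" using \<phi>[OF R1[of "[:[:0, 1:]:]"]] by (simp add: ev_simps eX map_poly_pCons)
  moreover have "\<phi> y = Y" using \<phi>[OF R1[of "[:0, 1:]"]] by (simp add: ev_simps eX map_poly_pCons)
  ultimately show ?thesis by blast
qed

lemma hom_eq_id:
  assumes "is_ring_hom \<phi>" "\<And>c. \<phi> (\<iota> c) = \<iota> c" "\<phi> x = x" "\<phi> y = y"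
  shows "\<phi> f = f"
  using hom_eq_on_field_adjoin[of \<phi> id \<iota> "{x, y}" f] assms generated
  by (auto simp: is_ring_hom_def)

text \<open>The pair (X', Y') defines a candidate for the inverse. Both composites fix x and y,
  hence are the identity.\<close>

lemma automorphism_exists:
  assumes XY: "Y ^ q + Y = X ^ (q + 1)" "X \<notin> range \<iota>"
    and XY': "Y' ^ q + Y' = X' ^ (q + 1)" "X' \<notin> range \<iota>"
    and inv: "\<And>\<phi>. is_ring_hom \<phi> \<Longrightarrow> (\<And>c. \<phi> (\<iota> c) = \<iota> c) \<Longrightarrow> \<phi> x = X \<Longrightarrow> \<phi> y = Y \<Longrightarrow> \<phi> X' = x \<and> \<phi> Y' = y"
    and inv': "\<And>\<phi>. is_ring_hom \<phi> \<Longrightarrow> (\<And>c. \<phi> (\<iota> c) = \<iota> c) \<Longrightarrow> \<phi> x = X' \<Longrightarrow> \<phi> y = Y' \<Longrightarrow> \<phi> X = x \<and> \<phi> Y = y"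
  shows "\<exists>\<sigma>\<in>field_automorphisms \<iota>. \<sigma> x = X \<and> \<sigma> y = Y"
proof -
  obtain \<phi> where \<phi>: "is_ring_hom \<phi>" "\<And>c. \<phi> (\<iota> c) = \<iota> c" "\<phi> x = X" "\<phi> y = Y"
    using hom_extension[OF XY] by blast
  obtain \<psi> where \<psi>: "is_ring_hom \<psi>" "\<And>c. \<psi> (\<iota> c) = \<iota> c" "\<psi> x = X'" "\<psi> y = Y'"
    using hom_extension[OF XY'] by blast
  have "(\<phi> \<circ> \<psi>) f = f" for f
    by (rule hom_eq_id[of "\<phi> \<circ> \<psi>"]) (use inv[OF \<phi>] \<phi> \<psi> in \<open>auto simp: is_ring_hom_comp\<close>)
  moreover have "(\<psi> \<circ> \<phi>) f = f" for f
    by (rule hom_eq_id[of "\<psi> \<circ> \<phi>"]) (use inv'[OF \<psi>] \<phi> \<psi> in \<open>auto simp: is_ring_hom_comp\<close>)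
  ultimately have "bij \<phi>" by (intro o_bij[of \<psi>]) auto
  then show ?thesis using \<phi> by (auto simp: field_automorphisms_def)
qed

end

section \<open>Discrete valuations and the affine places\<close>

text \<open>
  A normalized discrete valuation that is trivial on the image of \<open>\<iota>\<close>. The value at \<open>0\<close> is the
  junk value \<open>0\<close> (instead of infinity), so that a valuation is determined by its values on nonzero
  elements; \<open>vge v n a\<close> is the inequality \<open>n \<le> v a\<close> with the usual convention for \<open>a = 0\<close>.
\<close>

definition dval :: "('k::field \<Rightarrow> 'f::field) \<Rightarrow> ('f \<Rightarrow> int) \<Rightarrow> bool" where
  "dval \<iota> v \<longleftrightarrow> v 0 = 0 \<and> (\<forall>a b. a \<noteq> 0 \<longrightarrow> b \<noteq> 0 \<longrightarrow> v (a * b) = v a + v b) \<and>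
     (\<forall>a b. a \<noteq> 0 \<longrightarrow> b \<noteq> 0 \<longrightarrow> a + b \<noteq> 0 \<longrightarrow> min (v a) (v b) \<le> v (a + b)) \<and>
     (\<forall>c. v (\<iota> c) = 0) \<and> (\<exists>s. v s = 1)"

definition vge :: "('f::field \<Rightarrow> int) \<Rightarrow> int \<Rightarrow> 'f \<Rightarrow> bool" where
  "vge v n a \<longleftrightarrow> a = 0 \<or> n \<le> v a"

lemma vge_0 [simp]: "vge v n 0" by (simp add: vge_def)

lemma vge_mono: "vge v n a \<Longrightarrow> m \<le> n \<Longrightarrow> vge v m a" by (auto simp: vge_def)

lemma vgeD: "vge v n a \<Longrightarrow> a \<noteq> 0 \<Longrightarrow> n \<le> v a" by (auto simp: vge_def)

locale discrete_valuation =
  fixes \<iota> :: "'k::field \<Rightarrow> 'f::field" and v :: "'f \<Rightarrow> int"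
  assumes hom_base: "is_ring_hom \<iota>" and dval: "dval \<iota> v"
begin

lemma v_mult: "a \<noteq> 0 \<Longrightarrow> b \<noteq> 0 \<Longrightarrow> v (a * b) = v a + v b"
  and v_const: "v (\<iota> c) = 0" and v_0: "v 0 = 0"
  using dval by (auto simp: dval_def)

lemma uniformizer: obtains s where "v s = 1" "s \<noteq> 0"
  using dval unfolding dval_def by (metis zero_neq_one)

lemma v_1: "v 1 = 0" using v_const[of 1] by (simp add: is_ring_hom_simps[OF hom_base])

lemma v_uminus: "v (- a) = v a"
  using v_mult[of "- 1" a] v_const[of "- 1"]
  by (cases "a = 0") (auto simp: is_ring_hom_simps[OF hom_base])

lemma v_inverse: "v (inverse a) = - v a"
  using v_mult[of a "inverse a"] v_1 by (cases "a = 0") (auto simp: v_0)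

lemma v_divide: "a \<noteq> 0 \<Longrightarrow> b \<noteq> 0 \<Longrightarrow> v (a / b) = v a - v b"
  by (simp add: divide_inverse v_mult v_inverse)

lemma v_power: "v (a ^ n) = int n * v a"
proof (cases "a = 0")
  case False
  then show ?thesis by (induction n) (auto simp: v_1 v_mult algebra_simps)
qed (auto simp: power_0_left v_0 v_1)

lemma v_power_int: "v (a powi n) = n * v a"
  by (cases "n \<ge> 0") (auto simp: power_int_def v_power v_inverse)

lemma vge_add: "vge v n a \<Longrightarrow> vge v n b \<Longrightarrow> vge v n (a + b)"
  using dval unfolding dval_def vge_def by (smt (verit) add_0 add.right_neutral)

lemma vge_uminus: "vge v n (- a) \<longleftrightarrow> vge v n a"
  by (simp add: vge_def v_uminus)

lemma vge_diff: "vge v n a \<Longrightarrow> vge v n b \<Longrightarrow> vge v n (a - b)"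
  using vge_add[of n a "- b"] by (simp add: vge_uminus)

lemma vge_mult: "vge v n a \<Longrightarrow> vge v m b \<Longrightarrow> vge v (n + m) (a * b)"
  by (cases "a = 0"; cases "b = 0") (auto simp: vge_def v_mult)

lemma vge_power: "vge v n a \<Longrightarrow> vge v (int k * n) (a ^ k)"
  by (cases "a = 0") (auto simp: vge_def v_power v_1 power_0_left mult_left_mono)

lemma vge_const: "vge v 0 (\<iota> c)" by (simp add: vge_def v_const)

lemma vge_0_mult: "vge v 0 a \<Longrightarrow> vge v 0 b \<Longrightarrow> vge v 0 (a * b)"
  using vge_mult[of 0 a 0 b] by simp

lemma vge_sum: "(\<And>i. i \<in> A \<Longrightarrow> vge v n (f i)) \<Longrightarrow> vge v n (sum f A)"
  by (induction A rule: infinite_finite_induct) (auto intro: vge_add)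

lemma v_add_dominant:
  assumes "a \<noteq> 0" "vge v (v a + 1) b"
  shows "a + b \<noteq> 0" "v (a + b) = v a"
proof -
  have *: "\<not> vge v (v a + 1) a" using assms(1) by (auto simp: vge_def)
  then have "\<not> vge v (v a + 1) (a + b)" using vge_diff[of "v a + 1" "a + b" b] assms(2) by auto
  moreover have "vge v (v a) (a + b)"
    using vge_add[of "v a" a b] vge_mono[OF assms(2)] by (simp add: vge_def)
  ultimately show "a + b \<noteq> 0" "v (a + b) = v a" by (auto simp: vge_def)
qed

lemma not_vge_1_const:
  assumes "vge v 1 (\<iota> c)"
  shows "c = 0"
  using assms v_const[of c] is_ring_hom_field_simps(1)[OF hom_base] by (auto simp: vge_def)

lemma vge_poly: "vge v 0 z \<Longrightarrow> vge v 0 (poly (map_poly \<iota> d) z)"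
  by (induction d) (auto simp: map_poly_pCons is_ring_hom_simps[OF hom_base]
      intro!: vge_add vge_const vge_0_mult)

lemma vge_eval2: "vge v 0 X \<Longrightarrow> vge v 0 Y \<Longrightarrow> vge v 0 (eval2 \<iota> X Y P)"
  by (induction P) (auto simp: eval2_simps[OF hom_base] intro!: vge_add vge_poly vge_0_mult)

text \<open>Terms with pairwise different values cannot cancel: the value of the sum is the least
  value of a term.\<close>

lemma vge_terms:
  assumes "finite A" and nz: "\<And>i. i \<in> A \<Longrightarrow> f i \<noteq> 0" and inj: "inj_on (\<lambda>i. v (f i)) A"
    and "vge v n (sum f A)" and i: "i \<in> A"
  shows "n \<le> v (f i)"
proof -
  have "(\<lambda>i. v (f i)) ` A \<noteq> {}" using i by blast
  then obtain j where j: "j \<in> A" "v (f j) = Min ((\<lambda>i. v (f i)) ` A)"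
    using Min_in[of "(\<lambda>i. v (f i)) ` A"] assms(1) by fastforce
  have less: "v (f j) < v (f l)" if "l \<in> A - {j}" for l
  proof -
    have "v (f j) \<le> v (f l)" using j(2) assms(1) that by simp
    moreover have "v (f j) \<noteq> v (f l)" using inj j(1) that by (auto dest: inj_onD)
    ultimately show ?thesis by simp
  qed
  have "vge v (v (f j) + 1) (sum f (A - {j}))"
    using less by (intro vge_sum) (metis vge_def zless_imp_add1_zle)
  from v_add_dominant[OF nz[OF j(1)] this] have "v (sum f A) = v (f j)" "sum f A \<noteq> 0"
    using sum.remove[OF assms(1) j(1), of f] by auto
  then have "n \<le> v (f j)" using assms(4) by (auto simp: vge_def)
  then show ?thesis using j(2) assms(1) i by (metis Min_le finite_imageI imageI order.trans)
qed

end

text \<open>All linear factors z - a of \<open>d\<close> at z have value at least 0, so one of them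
  has to be positive when the product is.\<close>

lemma positive_at_root:
  fixes \<iota> :: "'k::alg_closed_field \<Rightarrow> 'f::field"
  assumes "is_ring_hom \<iota>" "dval \<iota> v" "vge v 0 z" "d \<noteq> 0" "vge v 1 (poly (map_poly \<iota> d) z)"
  obtains a where "poly d a = 0" "vge v 1 (z - \<iota> a)"
proof -
  interpret discrete_valuation \<iota> v by (standard) (use assms in auto)
  have "\<exists>a. poly d a = 0 \<and> vge v 1 (z - \<iota> a)" using assms(4,5)
  proof (induction "degree d" arbitrary: d)
    case 0
    then obtain c where c: "d = [:c:]" by (metis degree_eq_zeroE)
    then have "vge v 1 (\<iota> c)" using 0 by (simp add: map_poly_pCons is_ring_hom_simps[OF assms(1)])
    then have "c = 0" by (rule not_vge_1_const)
    then show ?case using 0 c by simp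
  next
    case (Suc n)
    then obtain a where a: "poly d a = 0" using alg_closed_imp_poly_has_root[of d] by auto
    then obtain g where g: "d = [:-a, 1:] * g" by (auto simp: poly_eq_0_iff_dvd)
    have "g \<noteq> 0" using g Suc by auto
    then have deg: "degree d = Suc (degree g)" unfolding g by (subst degree_mult_eq) auto
    have split: "poly (map_poly \<iota> d) z = (z - \<iota> a) * poly (map_poly \<iota> g) z"
      unfolding g is_ring_hom_simps[OF is_ring_hom_poly_map_poly[OF assms(1)]]
      by (simp add: map_poly_pCons is_ring_hom_simps[OF assms(1)])
    show ?case
    proof (cases "vge v 1 (z - \<iota> a)")
      case True
      then show ?thesis using a by blast
    next
      case False
      have "vge v 0 (z - \<iota> a)" using assms(3) vge_const vge_diff by blast
      then have "z - \<iota> a \<noteq> 0" "v (z - \<iota> a) = 0" using False by (auto simp: vge_def)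
      then have "vge v 1 (poly (map_poly \<iota> g) z)"
        using Suc.prems(2) unfolding split
        by (cases "poly (map_poly \<iota> g) z = 0") (auto simp: vge_def v_mult)
      then obtain c where "poly g c = 0" "vge v 1 (z - \<iota> c)"
        using Suc.hyps(1)[of g] Suc.hyps(2) deg \<open>g \<noteq> 0\<close> by auto
      then show ?thesis unfolding g by (intro exI[of _ c]) auto
    qed
  qed
  then show ?thesis using that by blast
qed

lemma synthetic_division:
  fixes c :: "'a::comm_ring_1 poly"
  obtains c' where "c = [:poly c a:] + [:-a, 1:] * c'"
proof -
  have "poly (c - [:poly c a:]) a = 0" by simp
  then obtain c' where "c - [:poly c a:] = [:-a, 1:] * c'" unfolding poly_eq_0_iff_dvd by (elim dvdE)
  then show ?thesis using that[of c'] by (simp add: algebra_simps)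
qed

section \<open>Residues, orders and valuations at the affine points\<close>

context hermitian
begin

definition on_curve :: "'k \<Rightarrow> 'k \<Rightarrow> bool" where
  "on_curve a b \<longleftrightarrow> b ^ q + b = a ^ (q + 1)"

definition centered :: "('f \<Rightarrow> int) \<Rightarrow> 'k \<Rightarrow> 'k \<Rightarrow> bool" where
  "centered v a b \<longleftrightarrow> vge v 1 (x - \<iota> a) \<and> vge v 1 (y - \<iota> b)"

abbreviation ev :: "'k poly poly \<Rightarrow> 'f" where "ev \<equiv> eval2 \<iota> x y"

text \<open>The value of a polynomial at (a, b). At a point of the curve it depends only on the
  element \<open>ev P\<close>, by \<open>res_cong\<close>, so it is the residue of that
  element.\<close>

definition res :: "'k \<Rightarrow> 'k \<Rightarrow> 'k poly poly \<Rightarrow> 'k" where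
  "res a b = eval2 id a b"

lemma hom_id: "is_ring_hom (id :: 'k \<Rightarrow> 'k)" by (simp add: is_ring_hom_def)

lemmas res_simps = eval2_simps[OF hom_id, folded res_def, simplified]

lemma res_ker:
  assumes "on_curve a b" "ev P = 0"
  shows "res a b P = 0"
proof -
  obtain R where "P = hermitian_poly q * R" using assms(2) kernel by (auto elim: dvdE)
  then show ?thesis using eval2_hermitian_poly[OF hom_id, of a b] assms(1)
    by (simp add: res_simps on_curve_def flip: res_def)
qed

lemma res_cong:
  assumes "on_curve a b" "ev P = ev P'"
  shows "res a b P = res a b P'"
  using res_ker[OF assms(1), of "P - P'"] assms(2) by (simp add: ev_simps res_simps)

lemma ev_neq_0:
  assumes "on_curve a b" "res a b P \<noteq> 0"
  shows "ev P \<noteq> 0"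
  using res_ker[OF assms(1)] assms(2) by blast

lemma px_division: obtains c' where "px c = \<iota> (poly c a) + (x - \<iota> a) * px c'"
proof -
  obtain c' where c': "c = [:poly c a:] + [:-a, 1:] * c'" by (rule synthetic_division)
  have "px c = px [:poly c a:] + px [:-a, 1:] * px c'"
    by (subst c') (simp only: px_simps)
  then show ?thesis using that[of c'] by (simp add: map_poly_pCons)
qed

lemma ev_X: "ev [:[:-a, 1:]:] = x - \<iota> a" and ev_Y: "ev [:[:-b:], 1:] = y - \<iota> b"
  and res_X: "res a b [:[:-a, 1:]:] = 0" and res_Y: "res a b [:[:-b:], 1:] = 0"
  by (simp_all add: ev_simps res_simps map_poly_pCons)

text \<open>Taylor expansion to first order: the polynomials that vanish at (a, b) form the ideal
  generated by X - a and Y - b.\<close>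

lemma ev_expand:
  "\<exists>P1 P2. ev P = \<iota> (res a b P) + (x - \<iota> a) * ev P1 + (y - \<iota> b) * ev P2"
proof (induction P)
  case 0
  then show ?case by (intro exI[of _ 0]) (simp add: ev_simps res_simps)
next
  case (pCons c P)
  then obtain P1 P2 where P: "ev P = \<iota> (res a b P) + (x - \<iota> a) * ev P1 + (y - \<iota> b) * ev P2" by blast
  obtain c' where c: "px c = \<iota> (poly c a) + (x - \<iota> a) * px c'" by (rule px_division)
  have "ev (pCons c P) = \<iota> (res a b (pCons c P)) + (x - \<iota> a) * ev (pCons c' P1)
      + (y - \<iota> b) * ev (pCons [:res a b P:] P2)"
    unfolding ev_simps(8) c P by (simp add: res_simps map_poly_pCons algebra_simps)
  then show ?case by blast
qed

text \<open>Says that \<open>n\<close> is the order of \<open>f\<close> at (a, b), with x - a as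
  uniformizer and quotients of polynomials that do not vanish at the point as units. It is a
  relation because existence and uniqueness of \<open>n\<close> are theorems about the curve;
  \<open>vP\<close> is read off afterwards.\<close>

definition loc :: "'k \<Rightarrow> 'k \<Rightarrow> int \<Rightarrow> 'f \<Rightarrow> bool" where
  "loc a b n f \<longleftrightarrow> (\<exists>G H. res a b G \<noteq> 0 \<and> res a b H \<noteq> 0 \<and> f = (x - \<iota> a) powi n * (ev G / ev H))"

lemma s_neq_0: "x - \<iota> a \<noteq> 0" using x_not_const by simp

lemma loc_mult: "loc a b n f \<Longrightarrow> loc a b m g \<Longrightarrow> loc a b (n + m) (f * g)"
  and loc_divide: "loc a b n f \<Longrightarrow> loc a b m g \<Longrightarrow> loc a b (n - m) (f / g)"
proof -
  assume "loc a b n f" "loc a b m g"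
  then obtain G H G' H' where *: "res a b G \<noteq> 0" "res a b H \<noteq> 0" "f = (x - \<iota> a) powi n * (ev G / ev H)"
    "res a b G' \<noteq> 0" "res a b H' \<noteq> 0" "g = (x - \<iota> a) powi m * (ev G' / ev H')" unfolding loc_def by blast
  show "loc a b (n + m) (f * g)" unfolding loc_def
    by (intro exI[of _ "G * G'"] exI[of _ "H * H'"])
      (use * s_neq_0 in \<open>simp add: res_simps ev_simps power_int_add\<close>)
  show "loc a b (n - m) (f / g)" unfolding loc_def
    by (intro exI[of _ "G * H'"] exI[of _ "H * G'"])
      (use * s_neq_0[of a] in \<open>simp add: res_simps(4) ev_simps(4) power_int_diff divide_inverse mult_ac\<close>)
qed

lemma loc_unit: "res a b G \<noteq> 0 \<Longrightarrow> loc a b 0 (ev G)"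
  unfolding loc_def by (intro exI[of _ G] exI[of _ 1]) (auto simp: res_simps ev_simps)

lemma loc_s: "loc a b 1 (x - \<iota> a)"
  unfolding loc_def by (intro exI[of _ 1] exI[of _ 1]) (auto simp: res_simps ev_simps)

lemma loc_neq_0: "on_curve a b \<Longrightarrow> loc a b n f \<Longrightarrow> f \<noteq> 0"
  unfolding loc_def using ev_neq_0 s_neq_0 by auto

lemma loc_ev_nonneg:
  assumes "on_curve a b" "loc a b n (ev N)"
  shows "n \<ge> 0" and "res a b N = 0 \<Longrightarrow> n \<ge> 1"
proof -
  from assms(2) obtain G H where *: "res a b G \<noteq> 0" "res a b H \<noteq> 0"
    "ev N = (x - \<iota> a) powi n * (ev G / ev H)" unfolding loc_def by blast
  note nz = ev_neq_0[OF assms(1) *(2)] s_neq_0[of a]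
  show "n \<ge> 0"
  proof (rule ccontr)
    assume "\<not> n \<ge> 0"
    \<comment> \<open>With n = -(k + 1) one factor x - a is kept apart from the k-th power. It
      forces the residue of \<open>ev G\<close> to be 0.\<close>
    define k where "k = nat (- n - 1)"
    have "n = - int (Suc k)" using \<open>\<not> n \<ge> 0\<close> by (simp add: k_def)
    then have "(x - \<iota> a) powi n = inverse ((x - \<iota> a) ^ Suc k)"
      by (simp only: power_int_minus power_int_of_nat)
    then have "ev N * ev H * (x - \<iota> a) ^ Suc k = ev G"
      using *(3) nz by (simp add: field_simps)
    then have "ev ([:[:-a, 1:]:] * (N * H * [:[:-a, 1:]:] ^ k)) = ev G"
      unfolding ev_simps(4,7) ev_X by (simp add: algebra_simps)
    from res_cong[OF assms(1) this] have "res a b G = 0" unfolding res_simps(4) res_X by simp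
    then show False using * by simp
  qed
  show "n \<ge> 1" if "res a b N = 0"
  proof (rule ccontr)
    assume "\<not> n \<ge> 1"
    then have "n = 0" using \<open>n \<ge> 0\<close> by simp
    then have "ev (N * H) = ev G" using *(3) nz unfolding ev_simps(4) by simp
    from res_cong[OF assms(1) this] have "res a b G = 0" using that unfolding res_simps(4) by simp
    then show False using * by simp
  qed
qed

lemma loc_unique:
  assumes "on_curve a b" "loc a b n f" "loc a b m f"
  shows "n = m"
proof -
  have "loc a b (n - m) (ev 1)" "loc a b (m - n) (ev 1)"
    using loc_divide[OF assms(2,3)] loc_divide[OF assms(3,2)] loc_neq_0[OF assms(1,2)]
    by (simp_all add: ev_simps)
  then show ?thesis using loc_ev_nonneg(1)[OF assms(1), of "n - m" 1] loc_ev_nonneg(1)[OF assms(1), of "m - n" 1]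
    by simp
qed

text \<open>
  So \<open>x - a\<close> is a uniformizer at every affine point; this holds because the curve equation is
  separable in \<open>y\<close>.
\<close>

lemma tangent_relation:
  assumes "on_curve a b"
  obtains C E where "res a b E \<noteq> 0" "(y - \<iota> b) * ev E = (x - \<iota> a) * ev C"
proof -
  obtain c' where c: "px (monom 1 (q + 1)) = \<iota> (poly (monom 1 (q + 1)) a) + (x - \<iota> a) * px c'"
    by (rule px_division)
  have c: "x ^ (q + 1) - \<iota> (a ^ (q + 1)) = (x - \<iota> a) * px c'"
    using c by (simp add: map_poly_monom poly_monom)
  \<comment> \<open>The cofactor of y - b in (y - b)^q + (y - b), which by additivity of Frobenius
    is the difference of the curve equation at y and at b. Its residue is 1.\<close>
  define E where "E = [:[:-b:], 1:] ^ (q - 1) + (1 :: 'k poly poly)"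
  have "(y - \<iota> b) * (y - \<iota> b) ^ (q - 1) = (y - \<iota> b) ^ q"
    using q_ge_3 by (metis power_eq_if not_numeral_le_zero)
  then have "(y - \<iota> b) * ev E = (y - \<iota> b) ^ q + (y - \<iota> b)"
    unfolding E_def ev_simps(2,3,7) ev_Y by (simp add: algebra_simps)
  also have "\<dots> = (y ^ q + y) - \<iota> (b ^ q + b)" by (simp add: frob1_f)
  also have "\<dots> = (x - \<iota> a) * ev [:c':]"
    using assms c curve unfolding on_curve_def eval2_const by simp
  finally have "(y - \<iota> b) * ev E = (x - \<iota> a) * ev [:c':]" .
  moreover have "res a b E \<noteq> 0"
    unfolding E_def res_simps(2,3,7) res_Y using q_ge_3 by (simp add: power_0_left)
  ultimately show ?thesis using that by blast
qed

text \<open>The cofactor \<open>M\<close> bounds how often x - a can be extracted from N. If N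
  vanishes at the point, expansion and the tangent relation give E N = (x - a) N' with a unit E, and
  the exponent \<open>k\<close> for N' is smaller by one.\<close>

lemma loc_exists_aux:
  assumes ab: "on_curve a b"
  shows "res a b D \<noteq> 0 \<Longrightarrow> ev N * ev M = (x - \<iota> a) ^ k * ev D \<Longrightarrow> \<exists>n. loc a b n (ev N)"
proof (induction k arbitrary: N D)
  case 0
  then have "ev (N * M) = ev D" by (simp add: ev_simps)
  from res_cong[OF ab this] have "res a b N \<noteq> 0" using 0 by (auto simp: res_simps)
  then show ?case using loc_unit by blast
next
  case (Suc k)
  show ?case
  proof (cases "res a b N = 0")
    case False
    then show ?thesis using loc_unit by blast
  next
    case True
    obtain C E where CE: "res a b E \<noteq> 0" "(y - \<iota> b) * ev E = (x - \<iota> a) * ev C"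
      using tangent_relation[OF ab] .
    obtain N1 N2 where N: "ev N = (x - \<iota> a) * ev N1 + (y - \<iota> b) * ev N2"
      using ev_expand[of N a b] True by auto
    define N' where "N' = E * N1 + C * N2"
    have "ev E * ev N = (x - \<iota> a) * (ev E * ev N1) + ((y - \<iota> b) * ev E) * ev N2"
      unfolding N by (simp add: algebra_simps)
    then have N': "ev E * ev N = (x - \<iota> a) * ev N'"
      unfolding CE(2) N'_def ev_simps(3,4) by (simp add: algebra_simps)
    have "(x - \<iota> a) * (ev N' * ev M) = (x - \<iota> a) * ((x - \<iota> a) ^ k * ev (E * D))"
      using Suc.prems(2) N' unfolding ev_simps(4)
      by (metis (no_types, opaque_lifting) mult.assoc mult.left_commute power_Suc)
    then have "ev N' * ev M = (x - \<iota> a) ^ k * ev (E * D)" using s_neq_0[of a] by simp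
    moreover have "res a b (E * D) \<noteq> 0" using CE Suc.prems(1) by (simp add: res_simps)
    ultimately obtain n where "loc a b n (ev N')" using Suc.IH by blast
    then have "loc a b (1 + n - 0) ((x - \<iota> a) * ev N' / ev E)"
      using loc_divide[OF loc_mult[OF loc_s] loc_unit] CE(1) by blast
    moreover have "ev N = (x - \<iota> a) * ev N' / ev E"
      using N' ev_neq_0[OF ab CE(1)] by (simp add: field_simps)
    ultimately show ?thesis by auto
  qed
qed

lemma loc_exists:
  assumes ab: "on_curve a b" and "f \<noteq> 0"
  shows "\<exists>n. loc a b n f"
proof -
  have A: "\<exists>n. loc a b n (ev N)" if "ev N \<noteq> 0" for N
  proof -
    \<comment> \<open>The normal form of the inverse yields a multiple of \<open>ev N\<close> that
      is a polynomial in x alone, and there the power of x - a is the multiplicity of the root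
      a.\<close>
    obtain P d where P: "d \<noteq> 0" "inverse (ev N) = ev P / px d" by (rule fraction)
    obtain d' where d': "d = [:-a, 1:] ^ order a d * d'" "\<not> [:-a, 1:] dvd d'"
      using order_decomp[OF P(1)] by blast
    have "poly d' a \<noteq> 0" using d'(2) by (simp add: poly_eq_0_iff_dvd)
    have "ev N * ev P = px d" using P that px_eq_0_iff[of d] by (simp add: field_simps)
    also have "\<dots> = px [:-a, 1:] ^ order a d * ev [:d':]"
      by (subst d'(1)) (simp only: px_simps eval2_const)
    finally have "ev N * ev P = (x - \<iota> a) ^ order a d * ev [:d':]"
      by (simp add: map_poly_pCons)
    moreover have "res a b [:d':] \<noteq> 0" using \<open>poly d' a \<noteq> 0\<close> by (simp add: res_simps)
    ultimately show ?thesis using loc_exists_aux[OF ab] by blast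
  qed
  obtain P d where P: "d \<noteq> 0" "f = ev P / px d" by (rule fraction)
  then have "ev P \<noteq> 0" "ev [:d:] \<noteq> 0" using assms(2) px_eq_0_iff by (auto simp: eval2_const)
  then obtain n m where "loc a b n (ev P)" "loc a b m (ev [:d:])" using A by blast
  then show ?thesis using loc_divide P(2) by (metis eval2_const)
qed

definition vP :: "'k \<Rightarrow> 'k \<Rightarrow> 'f \<Rightarrow> int" where
  "vP a b f = (if f = 0 then 0 else THE n. loc a b n f)"

lemma vP_eq:
  assumes "on_curve a b" "loc a b n f"
  shows "vP a b f = n"
proof -
  have "(THE n. loc a b n f) = n"
    by (rule the_equality) (use assms loc_unique[OF assms(1)] in auto)
  then show ?thesis using loc_neq_0[OF assms] by (simp add: vP_def)
qed

lemma loc_vP: "on_curve a b \<Longrightarrow> f \<noteq> 0 \<Longrightarrow> loc a b (vP a b f) f"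
  using loc_exists vP_eq by metis

lemma dval_vP:
  assumes ab: "on_curve a b"
  shows "dval \<iota> (vP a b)"
  unfolding dval_def
proof (intro conjI allI impI)
  show "vP a b 0 = 0" by (simp add: vP_def)
  show "\<exists>s. vP a b s = 1" using vP_eq[OF ab loc_s] by blast
  show "vP a b (\<iota> c) = 0" for c
  proof (cases "c = 0")
    case False
    then show ?thesis using vP_eq[OF ab loc_unit[of a b "[:[:c:]:]"]]
      by (simp add: res_simps ev_simps map_poly_pCons)
  qed (simp add: vP_def)
  show "vP a b (f * g) = vP a b f + vP a b g" if "f \<noteq> 0" "g \<noteq> 0" for f g
    using vP_eq[OF ab loc_mult] loc_vP[OF ab] that by blast
  have aux: "vP a b f \<le> vP a b (f + g)"
    if fg: "f \<noteq> 0" "g \<noteq> 0" "f + g \<noteq> 0" "vP a b f \<le> vP a b g" for f g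
  proof -
    obtain G H where 1: "res a b G \<noteq> 0" "res a b H \<noteq> 0" "f = (x - \<iota> a) powi vP a b f * (ev G / ev H)"
      using loc_vP[OF ab fg(1)] unfolding loc_def by blast
    obtain G' H' where 2: "res a b G' \<noteq> 0" "res a b H' \<noteq> 0" "g = (x - \<iota> a) powi vP a b g * (ev G' / ev H')"
      using loc_vP[OF ab fg(2)] unfolding loc_def by blast
    \<comment> \<open>After the smaller power of x - a is factored out, the sum is a polynomial over
      a unit, and a polynomial has nonnegative order.\<close>
    define k where "k = nat (vP a b g - vP a b f)"
    define N where "N = G * H' + [:[:-a, 1:]:] ^ k * G' * H"
    have "(x - \<iota> a) powi vP a b g = (x - \<iota> a) powi vP a b f * (x - \<iota> a) ^ k"
      using fg(4) s_neq_0[of a] by (simp add: k_def flip: power_int_add power_int_of_nat)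
    then have "f + g = (x - \<iota> a) powi vP a b f * (ev G / ev H + (x - \<iota> a) ^ k * (ev G' / ev H'))"
      using 1(3) 2(3) by (simp add: algebra_simps)
    also have "ev G / ev H + (x - \<iota> a) ^ k * (ev G' / ev H') = ev N / ev (H * H')"
      unfolding N_def ev_simps(3,4,7) ev_X using ev_neq_0[OF ab 1(2)] ev_neq_0[OF ab 2(2)]
      by (simp add: field_simps)
    finally have eq: "f + g = (x - \<iota> a) powi vP a b f * (ev N / ev (H * H'))" .
    then have "ev N \<noteq> 0" using fg(3) by auto
    then obtain m where m: "loc a b m (ev N)" using loc_exists[OF ab] by blast
    have "loc a b (vP a b f) ((x - \<iota> a) powi vP a b f)"
      unfolding loc_def by (intro exI[of _ 1]) (simp add: res_simps ev_simps)
    moreover have "loc a b 0 (ev (H * H'))" using 1 2 by (intro loc_unit) (simp add: res_simps)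
    ultimately have "loc a b (vP a b f + (m - 0)) (f + g)"
      unfolding eq using loc_mult loc_divide m by blast
    from vP_eq[OF ab this] show ?thesis using loc_ev_nonneg(1)[OF ab m] by simp
  qed
  show "min (vP a b f) (vP a b g) \<le> vP a b (f + g)" if "f \<noteq> 0" "g \<noteq> 0" "f + g \<noteq> 0" for f g
    using aux[of f g] aux[of g f] that by (cases "vP a b f \<le> vP a b g") (auto simp: add.commute)
qed

lemma vP_s: "on_curve a b \<Longrightarrow> vP a b (x - \<iota> a) = 1"
  using vP_eq loc_s by blast

lemma vge_vP_ev:
  assumes "on_curve a b"
  shows "vge (vP a b) 0 (ev N)" "vge (vP a b) 1 (ev N) \<longleftrightarrow> res a b N = 0"
proof -
  show "vge (vP a b) 0 (ev N)"
    using loc_ev_nonneg(1)[OF assms loc_vP[OF assms]] by (auto simp: vge_def)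
  show "vge (vP a b) 1 (ev N) \<longleftrightarrow> res a b N = 0"
    using loc_ev_nonneg(2)[OF assms loc_vP[OF assms]] vP_eq[OF assms loc_unit[of a b N]] res_ker[OF assms, of N]
    by (cases "res a b N = 0") (auto simp: vge_def)
qed

lemma centered_vP: "on_curve a b \<Longrightarrow> centered (vP a b) a b"
  unfolding centered_def using vge_vP_ev(2)[of a b] res_X res_Y ev_X ev_Y by metis

text \<open>The centre makes \<open>v\<close> nonnegative on polynomials and zero on those with
  nonzero residue. So \<open>v\<close> is \<open>vP a b\<close> times v(x - a), and a positive
  integer factor of 1 is 1.\<close>

lemma centered_unique:
  assumes ab: "on_curve a b" and v: "dval \<iota> v" "centered v a b"
  shows "v = vP a b"
proof -
  interpret discrete_valuation \<iota> v by standard (use hom v in auto)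
  have xy: "vge v 1 (x - \<iota> a)" "vge v 1 (y - \<iota> b)" using v(2) by (auto simp: centered_def)
  have "vge v 0 x" "vge v 0 y"
    using vge_add[OF vge_mono[OF xy(1)] vge_const[of a]] vge_add[OF vge_mono[OF xy(2)] vge_const[of b]]
    by auto
  then have ev: "vge v 0 (ev P)" for P by (rule vge_eval2)
  have unit: "v (ev G) = 0" if "res a b G \<noteq> 0" for G
  proof -
    obtain P1 P2 where P: "ev G = \<iota> (res a b G) + ((x - \<iota> a) * ev P1 + (y - \<iota> b) * ev P2)"
      using ev_expand[of G a b] by (auto simp: add.assoc)
    have "vge v (1 + 0) ((x - \<iota> a) * ev P1 + (y - \<iota> b) * ev P2)"
      using xy ev by (intro vge_add vge_mult)
    then show ?thesis
      using v_add_dominant(2)[of "\<iota> (res a b G)"] that unfolding P by (simp add: v_const)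
  qed
  have v_eq: "v f = vP a b f * v (x - \<iota> a)" if nz: "f \<noteq> 0" for f
  proof -
    obtain G H where *: "res a b G \<noteq> 0" "res a b H \<noteq> 0" "f = (x - \<iota> a) powi vP a b f * (ev G / ev H)"
      using loc_vP[OF ab nz] unfolding loc_def by blast
    have "v f = v ((x - \<iota> a) powi vP a b f) + v (ev G / ev H)"
      using * s_neq_0[of a] ev_neq_0[OF ab] by (subst *(3), intro v_mult) auto
    then show ?thesis using * ev_neq_0[OF ab] by (simp add: v_power_int v_divide unit)
  qed
  obtain s where "v s = 1" "s \<noteq> 0" by (rule uniformizer)
  then have "v (x - \<iota> a) = 1"
    using v_eq[of s] xy(1) s_neq_0[of a] by (auto simp: vge_def zmult_eq_1_iff)
  then show ?thesis using v_eq v_0 by (intro ext) (auto simp: vP_def)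
qed

end

section \<open>Automorphisms and the place at infinity\<close>

context hermitian
begin

abbreviation Aut :: "('f \<Rightarrow> 'f) set" where "Aut \<equiv> field_automorphisms \<iota>"

lemma AutD:
  assumes "\<sigma> \<in> Aut"
  shows "bij \<sigma>" "is_ring_hom \<sigma>" "\<sigma> (\<iota> c) = \<iota> c"
  using assms by (auto simp: field_automorphisms_def)

lemma Aut_comp: "\<sigma> \<in> Aut \<Longrightarrow> \<tau> \<in> Aut \<Longrightarrow> \<sigma> \<circ> \<tau> \<in> Aut"
  by (auto simp: field_automorphisms_def bij_comp is_ring_hom_comp)

lemma Aut_inv:
  assumes "\<sigma> \<in> Aut"
  shows "inv \<sigma> \<in> Aut"
proof -
  note \<sigma> = AutD[OF assms]
  have eq: "inv \<sigma> a = b \<longleftrightarrow> a = \<sigma> b" for a b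
    using \<sigma>(1) by (metis bij_inv_eq_iff)
  have surj: "\<sigma> (inv \<sigma> a) = a" for a using \<sigma>(1) by (simp add: bij_is_surj surj_f_inv_f)
  have "is_ring_hom (inv \<sigma>)"
    unfolding is_ring_hom_def eq by (simp add: is_ring_hom_simps[OF \<sigma>(2)] surj)
  then show ?thesis using \<sigma>(1,3) by (auto simp: field_automorphisms_def bij_imp_bij_inv eq)
qed

lemma dval_comp:
  assumes "dval \<iota> v" "\<sigma> \<in> Aut"
  shows "dval \<iota> (v \<circ> \<sigma>)"
proof -
  note \<sigma> = AutD[OF assms(2)]
  note simps = is_ring_hom_simps[OF \<sigma>(2)] is_ring_hom_field_simps[OF \<sigma>(2)]
  obtain s where "v s = 1" using assms(1) by (auto simp: dval_def)
  then have "v (\<sigma> (inv \<sigma> s)) = 1" using \<sigma>(1) by (simp add: bij_is_surj surj_f_inv_f)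
  moreover have "\<sigma> a + \<sigma> b = 0 \<longleftrightarrow> a + b = 0" for a b
    using simps(8)[of "a + b"] by (simp add: simps(3))
  ultimately show ?thesis using assms(1) \<sigma>(3) unfolding dval_def by (auto simp: simps)
qed

lemma vge_comp:
  assumes "\<sigma> \<in> Aut"
  shows "vge (v \<circ> \<sigma>) n f \<longleftrightarrow> vge v n (\<sigma> f)"
  using is_ring_hom_field_simps(1)[OF AutD(2)[OF assms]] by (auto simp: vge_def)

section \<open>The involution, the translations and the scalings\<close>

lemma x_div_y_not_const: "x / y \<noteq> \<iota> c"
proof
  assume "x / y = \<iota> c"
  then have "x = \<iota> c * y" using y_neq_0 by (simp add: field_simps)
  moreover have "ev [:[:0, 1:], [:- c:]:] = x - \<iota> c * y"
    by (simp add: ev_simps map_poly_pCons)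
  ultimately have "ev [:[:0, 1:], [:- c:]:] = 0" by simp
  then show False using eval2_eq_0_small_degree[of "[:[:0, 1:], [:- c:]:]"] q_ge_3 by (cases "c = 0") auto
qed

lemma J_curve: "(1 / y) ^ q + 1 / y = (x / y) ^ (q + 1)"
proof -
  have "(1 / y) ^ q + 1 / y = (y ^ q + y) / y ^ (q + 1)" using y_neq_0 by (simp add: field_simps)
  then show ?thesis using curve by (simp add: power_divide)
qed

lemma J_exists: "\<exists>\<sigma>\<in>Aut. \<sigma> x = x / y \<and> \<sigma> y = 1 / y"
proof (rule automorphism_exists[OF J_curve _ J_curve])
  fix \<phi> :: "'f \<Rightarrow> 'f" assume \<phi>: "is_ring_hom \<phi>" "\<phi> x = x / y" "\<phi> y = 1 / y"
  then show "\<phi> (x / y) = x \<and> \<phi> (1 / y) = y"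
    using y_neq_0 is_ring_hom_simps(2)[OF \<phi>(1)] by (simp add: is_ring_hom_field_simps[OF \<phi>(1)])
  then show "\<phi> (x / y) = x \<and> \<phi> (1 / y) = y" .
qed (use x_div_y_not_const in auto)

text \<open>In homogeneous coordinates (x : y : 1) this exchanges the last two. It swaps the origin
  with the point at infinity.\<close>

definition J :: "'f \<Rightarrow> 'f" where "J = (SOME \<sigma>. \<sigma> \<in> Aut \<and> \<sigma> x = x / y \<and> \<sigma> y = 1 / y)"

lemma J: "J \<in> Aut" "J x = x / y" "J y = 1 / y"
  using someI_ex[of "\<lambda>\<sigma>. \<sigma> \<in> Aut \<and> \<sigma> x = x / y \<and> \<sigma> y = 1 / y"] J_exists unfolding J_def by blast+

lemma J_J: "J (J f) = f"
proof -
  note simps = is_ring_hom_simps[OF AutD(2)[OF J(1)]] is_ring_hom_field_simps[OF AutD(2)[OF J(1)]]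
  have "(J \<circ> J) f = f"
    by (rule hom_eq_id[of "J \<circ> J"])
      (use J(2,3) AutD(3)[OF J(1)] y_neq_0 is_ring_hom_comp[OF AutD(2)[OF J(1)] AutD(2)[OF J(1)]]
        in \<open>auto simp: simps\<close>)
  then show ?thesis by simp
qed

text \<open>Compare the curve equation with its q-th power. For this reason rationality of a point
  is always expressed by its first coordinate.\<close>

lemma rational_y:
  assumes "on_curve a b" "a ^ (q ^ 2) = a"
  shows "b ^ (q ^ 2) = b"
proof -
  have *: "b ^ q + b = a ^ (q + 1)" using assms(1) by (simp add: on_curve_def)
  have "(b ^ q + b) ^ q = (a ^ (q + 1)) ^ q" using * by simp
  then have "b ^ (q ^ 2) + b ^ q = a ^ (q ^ 2) * a ^ q"
    by (simp add: frob1_k power_mult_distrib power2_eq_square power_add flip: power_mult)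
  also have "\<dots> = b ^ q + b" using * assms(2) by simp
  finally show ?thesis by (simp add: add.commute)
qed

lemma translation_curve:
  assumes "on_curve a b" "a ^ (q ^ 2) = a"
  shows "(y + \<iota> (a ^ q) * x + \<iota> b) ^ q + (y + \<iota> (a ^ q) * x + \<iota> b) = (x + \<iota> a) ^ (q + 1)"
proof -
  have "(\<iota> a ^ q) ^ q = \<iota> a"
    using assms(2) by (simp add: power2_eq_square power_mult flip: \<iota>_simps(7))
  then have "(y + \<iota> (a ^ q) * x + \<iota> b) ^ q + (y + \<iota> (a ^ q) * x + \<iota> b)
      = (y ^ q + y) + \<iota> a * x ^ q + \<iota> (a ^ q) * x + \<iota> (b ^ q + b)"
    by (simp add: frob1_f power_mult_distrib)
  also have "\<dots> = (x + \<iota> a) ^ (q + 1)"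
    using assms(1) curve by (simp add: on_curve_def frob1_f algebra_simps)
  finally show ?thesis .
qed

lemma add_const_not_const: "x + \<iota> a \<notin> range \<iota>"
proof
  assume "x + \<iota> a \<in> range \<iota>"
  then obtain c where "x + \<iota> a = \<iota> c" by blast
  then have "x = \<iota> (c - a)" by (simp add: eq_diff_eq)
  then show False using x_not_const by blast
qed

text \<open>These are the parameters of the inverse translation: in the composite the constant term
  of y is b + b^q - a^(q+1) = 0.\<close>

lemma on_curve_inverse:
  assumes "on_curve a b" "a ^ (q ^ 2) = a"
  shows "on_curve (- a) (b ^ q)" "(- a) ^ (q ^ 2) = - a"
proof -
  have "(b ^ q) ^ q = b" using rational_y[OF assms] by (simp add: power2_eq_square power_mult)
  then show "on_curve (- a) (b ^ q)"
    using assms(1) by (simp add: on_curve_def frob1_k add.commute)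
  show "(- a) ^ (q ^ 2) = - a" using assms(2) by (simp add: frob_k)
qed

lemma translation_exists:
  assumes "on_curve a b" "a ^ (q ^ 2) = a"
  shows "\<exists>\<sigma>\<in>Aut. \<sigma> x = x + \<iota> a \<and> \<sigma> y = y + \<iota> (a ^ q) * x + \<iota> b"
proof (rule automorphism_exists[OF translation_curve[OF assms] add_const_not_const
      translation_curve[OF on_curve_inverse[OF assms]] add_const_not_const])
  have c: "\<iota> b ^ q + \<iota> b = \<iota> a ^ q * \<iota> a" using assms(1) unfolding on_curve_def
    by (metis \<iota>_simps(3,4,7) power_Suc2 Suc_eq_plus1)
  fix \<phi> :: "'f \<Rightarrow> 'f" assume \<phi>: "is_ring_hom \<phi>" "\<And>c. \<phi> (\<iota> c) = \<iota> c"
  have p: "\<phi> (\<iota> c ^ n) = \<iota> c ^ n" for c n using \<phi>(2)[of "c ^ n"] by simp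
  note simps = is_ring_hom_simps(3-6)[OF \<phi>(1)] \<phi>(2) p
  {
    assume 1: "\<phi> x = x + \<iota> a" "\<phi> y = y + \<iota> (a ^ q) * x + \<iota> b"
    show "\<phi> (x + \<iota> (- a)) = x \<and> \<phi> (y + \<iota> ((- a) ^ q) * x + \<iota> (b ^ q)) = y"
      unfolding simps 1 using c by (simp add: frob1_k frob1_f algebra_simps)
  }
  {
    assume 1: "\<phi> x = x + \<iota> (- a)" "\<phi> y = y + \<iota> ((- a) ^ q) * x + \<iota> (b ^ q)"
    show "\<phi> (x + \<iota> a) = x \<and> \<phi> (y + \<iota> (a ^ q) * x + \<iota> b) = y"
      unfolding simps 1 using c by (simp add: frob1_k frob1_f algebra_simps)
  }
qed

text \<open>The factor c^(q+1) is the norm of c, hence fixed by the q-th power, so it can be pulled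
  out of y^q + y.\<close>

lemma scaling_exists:
  assumes "c \<noteq> 0" "c ^ (q ^ 2) = c"
  shows "\<exists>\<sigma>\<in>Aut. \<sigma> x = \<iota> c * x \<and> \<sigma> y = \<iota> (c ^ (q + 1)) * y"
proof -
  have curve': "(\<iota> (e ^ (q + 1)) * y) ^ q + \<iota> (e ^ (q + 1)) * y = (\<iota> e * x) ^ (q + 1)"
    if "e ^ (q ^ 2) = e" for e
  proof -
    have "(\<iota> (e ^ (q + 1))) ^ q = \<iota> ((e ^ (q ^ 2)) * e ^ q)"
      by (simp add: power2_eq_square power_add power_mult_distrib flip: power_mult)
    also have "\<dots> = \<iota> (e ^ (q + 1))" unfolding that by simp
    finally have "(\<iota> (e ^ (q + 1)) * y) ^ q + \<iota> (e ^ (q + 1)) * y = \<iota> (e ^ (q + 1)) * (y ^ q + y)"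
      by (simp only: power_mult_distrib distrib_left)
    then show ?thesis unfolding curve by (simp add: power_mult_distrib)
  qed
  have nc: "\<iota> e * x \<notin> range \<iota>" if "e \<noteq> 0" for e
  proof
    assume "\<iota> e * x \<in> range \<iota>"
    then obtain d where "\<iota> e * x = \<iota> d" by blast
    then have "x = \<iota> (d / e)" using that by (simp add: field_simps)
    then show False using x_not_const by blast
  qed
  have e: "inverse c \<noteq> 0" "(inverse c) ^ (q ^ 2) = inverse c" using assms by (auto simp: power_inverse)
  have e1: "\<iota> c * \<iota> (inverse c) = 1" using assms(1) by simp
  have "c ^ (q + 1) * inverse c ^ (q + 1) = 1"
    using assms(1) by (metis power_mult_distrib power_one right_inverse)
  then have e2: "\<iota> (c ^ (q + 1)) * \<iota> (inverse c ^ (q + 1)) = 1" by (metis \<iota>_simps(2,4))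
  show ?thesis
  proof (rule automorphism_exists[OF curve'[OF assms(2)] nc[OF assms(1)] curve'[OF e(2)] nc[OF e(1)]])
    fix \<phi> :: "'f \<Rightarrow> 'f" assume \<phi>: "is_ring_hom \<phi>" "\<And>c. \<phi> (\<iota> c) = \<iota> c"
    note simps = is_ring_hom_simps(4)[OF \<phi>(1)] \<phi>(2)
    {
      assume "\<phi> x = \<iota> c * x" "\<phi> y = \<iota> (c ^ (q + 1)) * y"
      then show "\<phi> (\<iota> (inverse c) * x) = x \<and> \<phi> (\<iota> (inverse c ^ (q + 1)) * y) = y"
        unfolding simps using e1 e2 by (simp only: mult.assoc[symmetric] mult.commute[of "\<iota> (inverse _)"] mult.commute[of "\<iota> (inverse _ ^ _)"] mult_1 simp_thms)
    }
    {
      assume "\<phi> x = \<iota> (inverse c) * x" "\<phi> y = \<iota> (inverse c ^ (q + 1)) * y"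
      then show "\<phi> (\<iota> c * x) = x \<and> \<phi> (\<iota> (c ^ (q + 1)) * y) = y"
        unfolding simps using e1 e2 by (simp only: mult.assoc[symmetric] mult_1 simp_thms)
    }
  qed
qed

section \<open>The fibres of x and the number of elements of F_(q^2)\<close>

lemma of_nat_q: "of_nat q = (0 :: 'k)" "of_nat (q ^ 2) = (0 :: 'k)"
proof -
  have "p dvd q" using h q_def by (simp add: dvd_power)
  then show "of_nat q = (0 :: 'k)" using char_k by (simp add: of_nat_eq_0_iff_char_dvd)
  then show "of_nat (q ^ 2) = (0 :: 'k)" by (simp add: power2_eq_square)
qed

text \<open>As a polynomial in b the curve equation has derivative 1, so its q roots are
  distinct.\<close>

lemma card_fibre: "card {b. on_curve a b} = q"
proof -
  define f where "f = monom (1::'k) q + (monom 1 1 - [:a ^ (q + 1):])"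
  have deg: "degree f = q" unfolding f_def using q_ge_3
    by (subst degree_add_eq_left)
       (auto simp: degree_monom_eq intro!: degree_diff_less le_less_trans[OF degree_monom_le])
  have "pderiv f = 1"
    unfolding f_def pderiv_add pderiv_diff pderiv_monom using of_nat_q(1) by (simp add: pderiv_pCons)
  then have "card {b. poly f b = 0} = degree f"
    using deg q_ge_3 by (intro card_roots_separable) auto
  moreover have "{b. poly f b = 0} = {b. on_curve a b}"
    by (auto simp: f_def poly_monom on_curve_def algebra_simps)
  ultimately show ?thesis using deg by simp
qed

lemma card_Fq2: "card {a::'k. a ^ (q ^ 2) = a} = q ^ 2"
proof -
  define f where "f = monom (1::'k) (q ^ 2) - monom 1 1"
  have "q ^ 2 > 1" using one_less_power[of q 2] q_ge_3 by simp
  then have deg: "degree f = q ^ 2" unfolding f_def diff_conv_add_uminus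
    by (subst degree_add_eq_left) (auto simp: degree_monom_eq)
  have "pderiv f = - 1"
    unfolding f_def pderiv_diff pderiv_monom using of_nat_q(2) by (simp add: monom_altdef one_pCons)
  then have "card {b. poly f b = 0} = degree f"
    using deg q_ge_3 by (intro card_roots_separable) auto
  moreover have "{a. poly f a = 0} = {a. a ^ (q ^ 2) = a}"
    by (auto simp: f_def poly_monom algebra_simps)
  ultimately show ?thesis using deg by simp
qed

text \<open>Infinity is the origin transported along \<open>J\<close>; this makes everything known
  about affine points available there.\<close>

definition vinf :: "'f \<Rightarrow> int" where "vinf = vP 0 0 \<circ> J"

lemma on_curve_0: "on_curve 0 0"
  using q_ge_3 by (simp add: on_curve_def power_0_left)

lemma dval_vinf: "dval \<iota> vinf"
  unfolding vinf_def by (intro dval_comp dval_vP on_curve_0 J)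

text \<open>In y (1 + y^(q-1)) = x^(q+1) the second factor is a unit at the origin: the tangent y =
  0 meets the curve there with multiplicity q + 1.\<close>

lemma vP_0_y: "vP 0 0 y = int q + 1"
proof -
  interpret discrete_valuation \<iota> "vP 0 0" by standard (use hom dval_vP[OF on_curve_0] in auto)
  have "vge (vP 0 0) 1 y" using centered_vP[OF on_curve_0] by (simp add: centered_def)
  then have "vge (vP 0 0) (int (q - 1) * 1) (y ^ (q - 1))" by (rule vge_power)
  then have "vge (vP 0 0) 1 (y ^ (q - 1))" by (rule vge_mono) (use q_ge_3 in simp)
  then have u: "1 + y ^ (q - 1) \<noteq> 0" "vP 0 0 (1 + y ^ (q - 1)) = 0"
    using v_add_dominant[of 1] by (simp_all add: v_1)
  have "y * (1 + y ^ (q - 1)) = y + y * y ^ (q - 1)" by (simp add: algebra_simps)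
  also have "y * y ^ (q - 1) = y ^ q" using q_ge_3 by (metis power_eq_if not_numeral_le_zero)
  finally have eq: "y * (1 + y ^ (q - 1)) = x ^ (q + 1)" using curve by (simp add: add.commute)
  have "vP 0 0 (y * (1 + y ^ (q - 1))) = vP 0 0 y"
    using u v_mult[OF y_neq_0 u(1)] by simp
  moreover have "vP 0 0 (x ^ (q + 1)) = int (q + 1)"
    using vP_s[OF on_curve_0] unfolding v_power by simp
  ultimately show ?thesis using eq by simp
qed

lemma vinf_xy: "vinf x = - int q" "vinf y = - (int q + 1)"
proof -
  interpret discrete_valuation \<iota> "vP 0 0" by standard (use hom dval_vP[OF on_curve_0] in auto)
  show "vinf x = - int q" "vinf y = - (int q + 1)"
    using vP_0_y vP_s[OF on_curve_0] x_neq_0 y_neq_0 v_1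
    by (simp_all add: vinf_def J v_divide)
qed

section \<open>Classification of the valuations: affine points and infinity\<close>

lemma q_mult_neg:
  fixes n :: int
  assumes "n < 0"
  shows "int q * n + 1 \<le> n"
proof -
  have "int q * n \<le> 3 * n" using q_ge_3 assms by (intro mult_right_mono_neg) auto
  then show ?thesis using assms by linarith
qed

text \<open>At a pole of Y the term Y^q strictly dominates Y, so X would have a pole too.\<close>

lemma vge_y_of_vge_x:
  assumes "dval \<iota> v" "Y ^ q + Y = X ^ (q + 1)" "vge v 0 X"
  shows "vge v 0 Y"
proof (rule ccontr)
  interpret discrete_valuation \<iota> v by standard (use hom assms in auto)
  assume "\<not> vge v 0 Y"
  then have Y: "Y \<noteq> 0" "v Y < 0" by (auto simp: vge_def)
  have "int q * v Y + 1 \<le> v Y" using Y(2) by (rule q_mult_neg)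
  then have "v (Y ^ q + Y) = int q * v Y" "Y ^ q + Y \<noteq> 0"
    using v_add_dominant[of "Y ^ q" Y] Y by (auto simp: v_power vge_def)
  moreover have "vge v 0 (X ^ (q + 1))" using vge_power[OF assms(3), of "q + 1"] by simp
  moreover have "int q * v Y < 0" using Y q_ge_3 by (simp add: mult_pos_neg)
  ultimately show False using assms(2) by (auto simp: vge_def)
qed

text \<open>A pole of x is a pole of y, and comparison of the dominant terms gives (q + 1) v(x) = q
  v(y), hence v(y) < v(x) < 0. So x / y and 1 / y both vanish, which means that \<open>J\<close>
  brings the centre to the origin.\<close>

lemma negative_unique:
  assumes v: "dval \<iota> v" and "v x < 0"
  shows "v = vinf"
proof -
  interpret discrete_valuation \<iota> v by standard (use hom v in auto)
  have "\<not> vge v 0 y"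
  proof
    assume "vge v 0 y"
    then have "vge v 0 (y ^ q + y)" using vge_power[of 0 y q] by (intro vge_add) auto
    then have "0 \<le> v (x ^ (q + 1))" unfolding curve using x_neq_0 by (auto simp: vge_def)
    then show False using assms(2) unfolding v_power by (simp add: zero_le_mult_iff)
  qed
  then have Y: "v y < 0" by (auto simp: vge_def)
  have "int q * v y + 1 \<le> v y" using Y by (rule q_mult_neg)
  then have "v (y ^ q + y) = int q * v y"
    using v_add_dominant[of "y ^ q" y] y_neq_0 by (auto simp: v_power vge_def)
  then have eq: "int (q + 1) * v x = int q * v y" unfolding curve v_power by simp
  have "v y < v x"
  proof -
    have "int q * v y = int q * v x + v x" using eq by (simp add: algebra_simps)
    then have "int q * v y < int q * v x" using assms(2) by simp
    then show ?thesis using q_ge_3 by (simp add: mult_less_cancel_left)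
  qed
  then have "centered (v \<circ> J) 0 0"
    using Y x_neq_0 y_neq_0 v_1 by (simp add: centered_def vge_comp[OF J(1)] J vge_def v_divide)
  then have "v \<circ> J = vP 0 0"
    using centered_unique[OF on_curve_0 dval_comp[OF v J(1)]] by blast
  then show ?thesis unfolding vinf_def by (auto simp: fun_eq_iff J_J dest: spec[of _ "J _"])
qed

text \<open>Some polynomial in x must have positive value; otherwise each \<open>ev N\<close>, which
  divides a polynomial in x, would have value 0, and there would be no uniformizer. A root of that
  polynomial gives a, and then the curve equation at x = a gives b.\<close>

lemma center_exists:
  assumes v: "dval \<iota> v" and x0: "vge v 0 x"
  shows "\<exists>a b. on_curve a b \<and> v = vP a b"
proof -
  interpret discrete_valuation \<iota> v by standard (use hom v in auto)
  have y0: "vge v 0 y" using vge_y_of_vge_x[OF v curve x0] .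
  have "\<exists>d. d \<noteq> 0 \<and> vge v 1 (px d)"
  proof (rule ccontr)
    assume "\<not> ?thesis"
    then have px: "v (px d) = 0" if "d \<noteq> 0" for d
      using that vge_poly[OF x0, of d] by (force simp: vge_def)
    have ev: "v (ev N) = 0" if "ev N \<noteq> 0" for N
    proof -
      obtain P d where P: "d \<noteq> 0" "inverse (ev N) = ev P / px d" by (rule fraction)
      have "ev N * ev P = px d" using P that px_eq_0_iff[of d] by (simp add: field_simps)
      moreover have "ev P \<noteq> 0" using P that by auto
      ultimately have "v (ev N) + v (ev P) = 0" using px[OF P(1)] that v_mult by metis
      moreover have "v (ev N) \<ge> 0" "v (ev P) \<ge> 0"
        using vge_eval2[OF x0 y0] that \<open>ev P \<noteq> 0\<close> by (auto simp: vge_def)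
      ultimately show ?thesis by simp
    qed
    obtain s where s: "v s = 1" "s \<noteq> 0" by (rule uniformizer)
    obtain P d where P: "d \<noteq> 0" "s = ev P / px d" by (rule fraction)
    then have "v s = v (ev P) - v (px d)" using s px_eq_0_iff[of d] v_divide by auto
    then show False using s P ev[of P] px[of d] by auto
  qed
  then obtain d where "d \<noteq> 0" "vge v 1 (px d)" by blast
  then obtain a where a: "vge v 1 (x - \<iota> a)"
    using positive_at_root[OF hom v x0] by blast
  obtain c' where c: "px (monom 1 (q + 1)) = \<iota> (poly (monom 1 (q + 1)) a) + (x - \<iota> a) * px c'"
    by (rule px_division)
  define m where "m = monom 1 q + monom 1 1 - [:a ^ (q + 1):]"
  have "poly (map_poly \<iota> m) y = y ^ q + y - \<iota> (a ^ (q + 1))"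
    unfolding m_def is_ring_hom_simps[OF is_ring_hom_poly_map_poly[OF hom]]
    by (simp add: map_poly_monom poly_monom map_poly_pCons)
  also have "\<dots> = (x - \<iota> a) * px c'" using c curve by (simp add: map_poly_monom poly_monom)
  finally have "vge v (1 + 0) (poly (map_poly \<iota> m) y)" using vge_mult[OF a vge_poly[OF x0]] by simp
  moreover have "m \<noteq> 0"
  proof
    assume "m = 0"
    then have "coeff m q = 0" by simp
    then show False using q_ge_3 by (simp add: m_def coeff_pCons split: nat.splits)
  qed
  ultimately obtain b where b: "poly m b = 0" "vge v 1 (y - \<iota> b)"
    using positive_at_root[OF hom v y0] by auto
  then have "on_curve a b" by (simp add: m_def poly_monom on_curve_def)
  then show ?thesis using centered_unique[OF _ v, of a b] a b by (auto simp: centered_def)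
qed

end

section \<open>The image of the place at infinity\<close>

lemma poly_eq_const: "(\<And>i. 1 \<le> i \<Longrightarrow> coeff p i = 0) \<Longrightarrow> p = [:coeff p 0:]"
  and poly_eq_linear: "(\<And>i. 2 \<le> i \<Longrightarrow> coeff p i = 0) \<Longrightarrow> p = [:coeff p 0, coeff p 1:]"
  and poly_eq_quadratic: "(\<And>i. 3 \<le> i \<Longrightarrow> coeff p i = 0) \<Longrightarrow> p = [:coeff p 0, coeff p 1, coeff p 2:]"
  by (auto simp: poly_eq_iff coeff_pCons numeral_2_eq_2 numeral_3_eq_3 split: nat.splits)

context hermitian
begin

section \<open>Elements with poles only at infinity\<close>

lemma res_poly: "res a b P = poly (map_poly (\<lambda>c. poly c a) P) b"
  by (simp add: res_def eval2_def)

text \<open>The roots of the denominator are cancelled one by one. At a root a the numerator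
  vanishes at all q points above a, but for x = a it is a polynomial in Y of degree less than q, so
  it is zero there and X - a divides each of its coefficients.\<close>

lemma regular_imp_polynomial:
  assumes reg: "\<And>a b. on_curve a b \<Longrightarrow> vge (vP a b) 0 f"
  obtains P where "degree P < q" "f = ev P"
proof -
  have "\<exists>P. degree P < q \<and> f = ev P" if "d \<noteq> 0" "degree P < q" "f = ev P / px d" for d P
    using that
  proof (induction "degree d" arbitrary: d P)
    case 0
    then obtain c where c: "d = [:c:]" by (metis degree_eq_zeroE)
    then have "c \<noteq> 0" using 0 by auto
    have "ev ([:[:inverse c:]:] * P) = \<iota> (inverse c) * ev P"
      unfolding ev_simps(4) by (simp add: ev_simps map_poly_pCons)
    moreover have "px d = \<iota> c" using c by (simp add: map_poly_pCons)
    ultimately have "f = ev ([:[:inverse c:]:] * P)" using 0(4) by (simp add: field_simps)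
    moreover have "degree ([:[:inverse c:]:] * P) < q"
      using 0(3) \<open>c \<noteq> 0\<close> by (simp add: degree_smult_eq)
    ultimately show ?case by blast
  next
    case (Suc n)
    then obtain a where "poly d a = 0" using alg_closed_imp_poly_has_root[of d] by auto
    then obtain d' where d': "d = [:-a, 1:] * d'" unfolding poly_eq_0_iff_dvd by (elim dvdE)
    have "d' \<noteq> 0" using d' Suc by auto
    then have deg: "degree d = Suc (degree d')" unfolding d' by (subst degree_mult_eq) auto
    have pd: "px d = (x - \<iota> a) * px d'" unfolding d' px_simps(4) by (simp add: map_poly_pCons)
    have root: "res a b P = 0" if ab: "on_curve a b" for b
    proof -
      interpret discrete_valuation \<iota> "vP a b" by standard (use hom dval_vP[OF ab] in auto)
      have "vge (vP a b) (0 + (1 + 0)) (f * ((x - \<iota> a) * ev [:d':]))"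
        using reg[OF ab] vP_s[OF ab] vge_vP_ev(1)[OF ab] by (intro vge_mult) (auto simp: vge_def)
      moreover have "ev P = f * px d" using Suc.prems(1,3) px_eq_0_iff by simp
      ultimately have "vge (vP a b) 1 (ev P)" by (simp only: pd eval2_const add_0 add_0_right)
      then show ?thesis using vge_vP_ev(2)[OF ab] by blast
    qed
    define R where "R = map_poly (\<lambda>c. poly c a) P"
    have "R = 0"
    proof (rule ccontr)
      assume "R \<noteq> 0"
      have "{b. on_curve a b} \<subseteq> {b. poly R b = 0}" using root by (auto simp: res_poly R_def)
      then have "q \<le> card {b. poly R b = 0}"
        using card_mono[OF poly_roots_finite[OF \<open>R \<noteq> 0\<close>]] card_fibre by metis
      also have "\<dots> \<le> degree R" by (rule card_poly_roots_bound[OF \<open>R \<noteq> 0\<close>])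
      also have "\<dots> \<le> degree P" unfolding R_def by (rule map_poly_degree_leq)
      finally show False using Suc.prems(2) by simp
    qed
    then have "poly (coeff P i) a = 0" for i
      using coeff_map_poly[of "\<lambda>c. poly c a" P i] by (simp add: R_def)
    then have dv: "[:-a, 1:] dvd coeff P i" for i by (simp add: poly_eq_0_iff_dvd)
    define P' where "P' = map_poly (\<lambda>c. c div [:-a, 1:]) P"
    have "coeff P i = [:-a, 1:] * coeff P' i" for i
    proof -
      have "coeff P' i = coeff P i div [:-a, 1:]" by (simp add: P'_def coeff_map_poly)
      then show ?thesis using dvd_mult_div_cancel[OF dv[of i]] by metis
    qed
    then have P: "P = [:[:-a, 1:]:] * P'" by (auto simp: poly_eq_iff)
    have "degree P' < q" using map_poly_degree_leq[of _ P] Suc.prems(2) unfolding P'_def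
      by (rule le_less_trans)
    moreover have "f = ev P' / px d'"
      using Suc.prems(3) mult_divide_mult_cancel_left[OF s_neq_0[of a], of "ev P'" "px d'"]
      unfolding pd by (subst (asm) P) (simp only: ev_simps(4) ev_X)
    ultimately show ?case using Suc.hyps(1)[of d' P'] Suc.hyps(2) deg \<open>d' \<noteq> 0\<close> by auto
  qed
  moreover obtain P d where "d \<noteq> 0" "degree P < q" "f = ev P / px d" by (rule fraction)
  ultimately show ?thesis using that by blast
qed

lemma vinf_px: "c \<noteq> 0 \<Longrightarrow> vinf (px c) = - (int q * int (degree c))"
proof (induction c)
  interpret discrete_valuation \<iota> vinf by standard (use hom dval_vinf in auto)
  case (pCons a c)
  show ?case
  proof (cases "c = 0")
    case True
    then show ?thesis by (simp add: map_poly_pCons v_const)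
  next
    case False
    have nz: "x * px c \<noteq> 0" using x_neq_0 px_eq_0_iff[of c] False by simp
    have v: "vinf (x * px c) = - (int q * (1 + int (degree c)))"
      using pCons.IH[OF False] False x_neq_0 px_eq_0_iff[of c] by (simp add: v_mult vinf_xy algebra_simps)
    have "vge vinf (vinf (x * px c) + 1) (\<iota> a)"
    proof (intro vge_mono[OF vge_const])
      have "int q * 1 \<le> int q * (1 + int (degree c))" by (intro mult_left_mono) auto
      then show "vinf (x * px c) + 1 \<le> 0" using v q_ge_3 by linarith
    qed
    from v_add_dominant(2)[OF nz this] v show ?thesis
      using False by (simp add: map_poly_pCons add.commute)
  qed
qed simp

text \<open>The term with y^j has pole order q * degree + (q + 1) j, congruent to j modulo q. As j <
  q, different terms have different orders and none can hide behind cancellation. In place of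
  Riemann-Roch, this determines which monomials a given pole order allows.\<close>

lemma pole_order_bound:
  assumes "degree P < q" "vge vinf (- int m) (ev P)" "coeff P j \<noteq> 0"
  shows "q * degree (coeff P j) + (q + 1) * j \<le> m"
proof -
  interpret discrete_valuation \<iota> vinf by standard (use hom dval_vinf in auto)
  define A where "A = {j. coeff P j \<noteq> 0}"
  define f where "f j = px (coeff P j) * y ^ j" for j
  have A: "A \<subseteq> {..<q}" using assms(1) le_degree[of P] unfolding A_def by (auto intro: le_less_trans)
  then have fin: "finite A" by (rule finite_subset) auto
  have nz: "f i \<noteq> 0" if "i \<in> A" for i using that y_neq_0 px_eq_0_iff by (auto simp: A_def f_def)
  have v: "vinf (f i) = - int (q * degree (coeff P i) + (q + 1) * i)" if "i \<in> A" for i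
    using that y_neq_0 px_eq_0_iff unfolding f_def A_def
    by (subst v_mult) (auto simp: vinf_px v_power vinf_xy algebra_simps)
  have "inj_on (\<lambda>i. vinf (f i)) A"
  proof (rule inj_onI)
    fix i j assume ij: "i \<in> A" "j \<in> A" "vinf (f i) = vinf (f j)"
    then have "int (q * degree (coeff P i) + (q + 1) * i) = int (q * degree (coeff P j) + (q + 1) * j)"
      using v[OF ij(1)] v[OF ij(2)] by linarith
    then have "q * degree (coeff P i) + (q + 1) * i = q * degree (coeff P j) + (q + 1) * j"
      unfolding of_nat_eq_iff .
    then have "(i + q * (degree (coeff P i) + i)) mod q = (j + q * (degree (coeff P j) + j)) mod q"
      by (simp add: algebra_simps)
    then have "i mod q = j mod q" by simp
    moreover have "i < q" "j < q" using A ij by auto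
    ultimately show "i = j" by simp
  qed
  moreover have "ev P = sum f A"
  proof -
    have "ev P = (\<Sum>i\<le>degree P. f i)"
      unfolding eval2_def f_def poly_altdef[of "map_poly (\<lambda>c. px c) P" y]
      by (subst degree_map_poly) (auto simp: px_eq_0_iff coeff_map_poly px_simps(1))
    also have "\<dots> = sum f A"
      by (rule sum.mono_neutral_right) (auto simp: A_def f_def le_degree)
    finally show ?thesis .
  qed
  ultimately have "- int m \<le> vinf (f j)"
    using vge_terms[OF fin nz] assms(2,3) by (auto simp: A_def)
  moreover have "j \<in> A" using assms(3) by (simp add: A_def)
  ultimately have "int (q * degree (coeff P j) + (q + 1) * j) \<le> int m" using v[of j] by linarith
  then show ?thesis unfolding of_nat_le_iff .
qed

section \<open>Where an automorphism can send infinity, and the automorphisms that fix it\<close>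

lemma regular_elsewhere:
  assumes "\<sigma> \<in> Aut" "dval \<iota> v" "v \<noteq> vinf \<circ> inv \<sigma>"
  shows "vge v 0 (\<sigma> x)" "vge v 0 (\<sigma> y)"
proof -
  note \<sigma> = AutD[OF assms(1)]
  show x: "vge v 0 (\<sigma> x)"
  proof (rule ccontr)
    assume "\<not> vge v 0 (\<sigma> x)"
    then have "(v \<circ> \<sigma>) x < 0" by (auto simp: vge_def)
    \<comment> \<open>A pole of \<open>\<sigma> x\<close> at v is a pole of x at
      \<open>v \<circ> \<sigma>\<close>, and x has a pole only at infinity.\<close>
    then have "v \<circ> \<sigma> = vinf" using negative_unique dval_comp assms by blast
    then have "v = vinf \<circ> inv \<sigma>" using \<sigma>(1) by (metis bij_is_surj comp_assoc comp_id surj_iff)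
    then show False using assms(3) by simp
  qed
  have "\<sigma> y ^ q + \<sigma> y = \<sigma> x ^ (q + 1)"
    using arg_cong[OF curve, of \<sigma>] by (simp only: is_ring_hom_simps[OF \<sigma>(2)])
  then show "vge v 0 (\<sigma> y)" using vge_y_of_vge_x[OF assms(2) _ x] by blast
qed

lemma vP_inject:
  assumes "on_curve a b" "on_curve c d" "vP a b = vP c d"
  shows "a = c \<and> b = d"
proof -
  interpret discrete_valuation \<iota> "vP a b" by standard (use hom dval_vP[OF assms(1)] in auto)
  have "centered (vP a b) a b" "centered (vP a b) c d"
    using centered_vP assms by metis+
  then have "vge (vP a b) 1 ((x - \<iota> c) - (x - \<iota> a))" "vge (vP a b) 1 ((y - \<iota> d) - (y - \<iota> b))"
    unfolding centered_def using vge_diff by blast+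
  then have "vge (vP a b) 1 (\<iota> (a - c))" "vge (vP a b) 1 (\<iota> (b - d))" by simp_all
  then show ?thesis using not_vge_1_const by fastforce
qed

lemma vge_vP_x: "on_curve a b \<Longrightarrow> vge (vP a b) 0 x"
  using vge_vP_ev(1)[of a b "[:[:0, 1:]:]"] by (simp add: ev_simps map_poly_pCons)

lemma vinf_neq_vP: "on_curve a b \<Longrightarrow> vinf \<noteq> vP a b"
  using vge_vP_x[of a b] vinf_xy(1) q_ge_3 x_neq_0 by (auto simp: vge_def)

text \<open>
  If the image \<open>P\<close> of infinity is not rational, the tangent \<open>l\<close> at \<open>P\<close> meets the curve \<open>q\<close> times in \<open>P\<close> and once in the Frobenius image of
  \<open>P\<close>. Then \<open>\<sigma> y * l^2\<close> is a conic that meets \<open>l\<close> at least twice in \<open>P\<close> and once in the Frobenius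
  image of \<open>P\<close>, so it contains \<open>l\<close>, which contradicts its order \<open>q - 1\<close> at \<open>P\<close>.
\<close>

lemma image_of_infinity_rational:
  assumes \<sigma>: "\<sigma> \<in> Aut" and ab: "on_curve a b" and place: "vinf \<circ> inv \<sigma> = vP a b"
  shows "a ^ (q ^ 2) = a"
proof (rule ccontr)
  assume nr: "a ^ (q ^ 2) \<noteq> a"
  interpret discrete_valuation \<iota> "vP a b" by standard (use hom dval_vP[OF ab] in auto)
  interpret inf: discrete_valuation \<iota> vinf by standard (use hom dval_vinf in auto)
  define s where "s = x - \<iota> a"
  \<comment> \<open>The tangent at (a, b) is y = b + a^q (x - a), because the derivative of the
    curve equation in y is 1.\<close>
  define m where "m = [:b - a ^ (q + 1), a ^ q:]"
  define l where "l = y - px m"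
  have l_ev: "l = ev [:- m, 1:]" by (simp add: l_def ev_simps px_simps)
  have px_m: "px m = \<iota> b + \<iota> (a ^ q) * s"
    by (simp add: m_def s_def map_poly_pCons algebra_simps)
  have cab: "\<iota> b ^ q + \<iota> b = \<iota> a ^ q * \<iota> a"
    using ab unfolding on_curve_def by (metis \<iota>_simps(3,4,7) power_Suc2 Suc_eq_plus1)
  have s: "vP a b s = 1" "s \<noteq> 0" using vP_s[OF ab] s_neq_0 by (auto simp: s_def)
  have aq: "\<iota> a ^ (q ^ 2) = (\<iota> a ^ q) ^ q" by (simp add: power2_eq_square power_mult)
  have x_s: "x = s + \<iota> a" by (simp add: s_def)
  have lq: "l ^ q = y ^ q - \<iota> b ^ q - \<iota> (a ^ (q ^ 2)) * s ^ q"
    by (simp add: l_def px_m frob1_f power_mult_distrib aq algebra_simps)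
  have yq: "y ^ q + y = (s ^ q + \<iota> a ^ q) * (s + \<iota> a)"
    unfolding curve by (subst x_s) (simp add: frob1_f algebra_simps)
  \<comment> \<open>The terms linear in \<open>s\<close> cancel. The coefficient a - a^(q^2) of s^q
    is nonzero because the point is not rational; this makes the contact order q and not q +
    1.\<close>
  have "l + l ^ q = (y ^ q + y) - (\<iota> b ^ q + \<iota> b) - \<iota> (a ^ q) * s - \<iota> (a ^ (q ^ 2)) * s ^ q"
    unfolding lq by (simp add: l_def px_m)
  also have "\<dots> = \<iota> (a - a ^ (q ^ 2)) * s ^ q + s ^ (q + 1)"
    unfolding yq cab by (simp add: algebra_simps)
  finally have rel: "l + l ^ q = \<iota> (a - a ^ (q ^ 2)) * s ^ q + s ^ (q + 1)" .
  have l0: "l \<noteq> 0" using eval2_eq_0_small_degree[of "[:- m, 1:]"] q_ge_3 unfolding l_ev by auto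
  have "res a b [:- m, 1:] = 0" by (simp add: res_simps m_def algebra_simps)
  then have l1: "vP a b l \<ge> 1" using vge_vP_ev(2)[OF ab] l0 unfolding l_ev by (metis vgeD)
  have vl: "vP a b l = int q"
  proof -
    have "vP a b l + 1 \<le> int q * vP a b l"
      using l1 mult_right_mono[of 3 "int q" "vP a b l"] q_ge_3 by linarith
    then have "vP a b (l + l ^ q) = vP a b l"
      using l0 by (intro v_add_dominant) (auto simp: vge_def v_power)
    moreover have "vP a b (\<iota> (a - a ^ (q ^ 2)) * s ^ q + s ^ (q + 1)) = vP a b (\<iota> (a - a ^ (q ^ 2)) * s ^ q)"
      and "vP a b (\<iota> (a - a ^ (q ^ 2)) * s ^ q) = int q"
    proof -
      have nz: "\<iota> (a - a ^ (q ^ 2)) \<noteq> 0" using nr by (metis \<iota>_simps(8) right_minus_eq)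
      then show v: "vP a b (\<iota> (a - a ^ (q ^ 2)) * s ^ q) = int q"
        using s by (simp only: v_mult v_const v_power power_eq_0_iff simp_thms)
      have "vge (vP a b) (int q + 1) (s ^ (q + 1))" using s unfolding vge_def v_power by simp
      then show "vP a b (\<iota> (a - a ^ (q ^ 2)) * s ^ q + s ^ (q + 1)) = vP a b (\<iota> (a - a ^ (q ^ 2)) * s ^ q)"
        using nz s unfolding v[symmetric] by (intro v_add_dominant) auto
    qed
    ultimately show ?thesis using rel by simp
  qed
  define Y where "Y = \<sigma> y"
  note \<sigma>' = AutD[OF \<sigma>]
  have "vP a b Y = vinf y"
    unfolding place[symmetric] Y_def using \<sigma>'(1) by (simp add: bij_is_inj)
  then have vY: "vP a b Y = - (int q + 1)" using vinf_xy by simp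
  have Y0: "Y \<noteq> 0" using y_neq_0 is_ring_hom_field_simps(1)[OF \<sigma>'(2)] by (simp add: Y_def)
  \<comment> \<open>At (a, b) the image of y has a pole of order q + 1 and l a zero of order q, so
    two factors l are needed; the order left over is 2q - (q + 1) = q - 1.\<close>
  define Q where "Q = Y * l ^ 2"
  have Q0: "Q \<noteq> 0" using Y0 l0 by (simp add: Q_def)
  have vQ: "vP a b Q = int q - 1" using Y0 l0 vY vl by (simp add: Q_def v_mult v_power)
  have reg: "vge (vP c d) 0 Y" if "on_curve c d" "(c, d) \<noteq> (a, b)" for c d
  proof -
    have "vP c d \<noteq> vinf \<circ> inv \<sigma>" using place vP_inject[OF ab that(1)] that(2) by metis
    then show ?thesis unfolding Y_def by (rule regular_elsewhere(2)[OF \<sigma> dval_vP[OF that(1)]])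
  qed
  have "vge (vP c d) 0 Q" if cd: "on_curve c d" for c d
  proof (cases "(c, d) = (a, b)")
    case True
    then show ?thesis using vQ q_ge_3 by (simp add: vge_def)
  next
    case False
    interpret cd: discrete_valuation \<iota> "vP c d" by standard (use hom dval_vP[OF cd] in auto)
    have "Q = Y * ev ([:- m, 1:] ^ 2)" by (simp only: Q_def l_ev ev_simps(7))
    then show ?thesis using reg[OF cd False] vge_vP_ev(1)[OF cd] by (auto intro: cd.vge_0_mult)
  qed
  then obtain P where P: "degree P < q" "Q = ev P" by (rule regular_imp_polynomial)
  have "vge vinf 0 Y"
    unfolding Y_def using regular_elsewhere(2)[OF \<sigma> dval_vinf] place vinf_neq_vP[OF ab] by auto
  moreover have "vge vinf (- int (q + 1)) l"
  proof -
    have "vge vinf (- int (q + 1)) (px m)"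
    proof (cases "m = 0")
      case False
      have "int q * int (degree m) \<le> int q * 1" by (intro mult_left_mono) (auto simp: m_def)
      then show ?thesis using vinf_px[OF False] by (simp add: vge_def)
    qed (simp add: px_simps)
    then show ?thesis unfolding l_def by (intro inf.vge_diff) (auto simp: vge_def vinf_xy)
  qed
  ultimately have "vge vinf (0 + int 2 * (- int (q + 1))) (Y * l ^ 2)"
    by (intro inf.vge_mult inf.vge_power)
  then have Qinf: "vge vinf (- int (2 * q + 2)) (ev P)" using P(2) by (simp add: Q_def algebra_simps)
  note bound = pole_order_bound[OF P(1) Qinf]
  define c0 c1 c2 where c_def: "c0 = coeff P 0" "c1 = coeff P 1" "c2 = coeff P 2"
  have "coeff P j = 0" if "3 \<le> j" for j
  proof (rule ccontr)
    assume "coeff P j \<noteq> 0"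
    from bound[OF this] have "(q + 1) * j \<le> 2 * q + 2" by simp
    moreover have "(q + 1) * 3 \<le> (q + 1) * j" using that by (rule mult_left_mono) simp
    ultimately show False by simp
  qed
  then have P_eq: "P = [:c0, c1, c2:]" unfolding c_def by (rule poly_eq_quadratic)
  \<comment> \<open>Pole order at most 2q + 2 leaves only monomials of total degree at most 2. The
    exclusion of x^3 needs 3q > 2q + 2; for q = 2 it would be allowed.\<close>
  have deg: "degree c0 \<le> 2" "degree c1 \<le> 1" "degree c2 \<le> 0"
  proof -
    show "degree c0 \<le> 2"
    proof (rule ccontr)
      assume *: "\<not> degree c0 \<le> 2"
      then have "q * 3 + (q + 1) * 0 \<le> q * degree c0 + (q + 1) * 0"
        by (intro add_right_mono mult_left_mono) auto
      moreover have "coeff P 0 \<noteq> 0" using * by (auto simp: c_def)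
      from bound[OF this] have "q * degree c0 + (q + 1) * 0 \<le> 2 * q + 2" by (simp add: c_def)
      ultimately have "q * 3 + (q + 1) * 0 \<le> 2 * q + 2" by (rule order_trans)
      then show False using q_ge_3 by simp
    qed
    show "degree c1 \<le> 1"
    proof (rule ccontr)
      assume *: "\<not> degree c1 \<le> 1"
      then have "q * 2 + (q + 1) * 1 \<le> q * degree c1 + (q + 1) * 1"
        by (intro add_right_mono mult_left_mono) auto
      moreover have "coeff P 1 \<noteq> 0" using * by (auto simp: c_def)
      from bound[OF this] have "q * degree c1 + (q + 1) * 1 \<le> 2 * q + 2" by (simp add: c_def)
      ultimately have "q * 2 + (q + 1) * 1 \<le> 2 * q + 2" by (rule order_trans)
      then show False using q_ge_3 by simp
    qed
    show "degree c2 \<le> 0" using bound[of 2] q_ge_3 by (cases "c2 = 0") (auto simp: c_def)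
  qed
  \<comment> \<open>The restriction of the conic to the tangent, of degree at most 2 in x; Q and
    R(x) differ by a multiple of l.\<close>
  define R where "R = poly P m"
  have degR: "degree R \<le> 2"
  proof -
    have m1: "degree m \<le> 1" by (simp add: m_def)
    have "degree (m * c2) \<le> 1" using degree_mult_le[of m c2] m1 deg by linarith
    then have "degree (c1 + m * c2) \<le> 1" using deg by (intro degree_add_le)
    then have "degree (m * (c1 + m * c2)) \<le> 2" using degree_mult_le[of m "c1 + m * c2"] m1 by linarith
    then show ?thesis unfolding R_def P_eq using deg by (simp add: degree_add_le)
  qed
  obtain P' where P': "P = [:R:] + [:- m, 1:] * P'" unfolding R_def by (rule synthetic_division)
  have Q_split: "Q = px R + l * ev P'"
    unfolding P(2) l_ev by (subst P') (simp only: ev_simps(3,4) eval2_const)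
  have lP: "vge (vP a b) (int q) (l * ev P')"
    using vge_mult[of "int q" l 0 "ev P'"] vl vge_vP_ev(1)[OF ab] by (simp add: vge_def)
  have "R \<noteq> 0"
  proof
    assume "R = 0"
    then have "vge (vP a b) (int q) Q" using lP by (simp add: Q_split px_simps)
    then show False using vQ Q0 by (simp add: vge_def)
  qed
  \<comment> \<open>The order q - 1 of Q is at least 2, again by q > 2. This gives the double root a
    of R.\<close>
  have "vge (vP a b) 2 (Q - l * ev P')"
    using vQ q_ge_3 by (intro vge_diff vge_mono[OF lP]) (auto simp: vge_def)
  then have vR: "vge (vP a b) 2 (px R)" by (simp add: Q_split)
  then have "vge (vP a b) 1 (ev [:R:])" unfolding eval2_const by (rule vge_mono) simp
  then have "poly R a = 0" using vge_vP_ev(2)[OF ab] by (simp add: res_simps)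
  then obtain R1 where R1: "R = [:-a, 1:] * R1" unfolding poly_eq_0_iff_dvd by (elim dvdE)
  have "px R = s * px R1" unfolding R1 px_simps(4) by (simp add: map_poly_pCons s_def)
  then have "vge (vP a b) 1 (ev [:R1:])"
    using vR s unfolding eval2_const by (cases "px R1 = 0") (auto simp: vge_def v_mult)
  then have "poly R1 a = 0" using vge_vP_ev(2)[OF ab] by (simp add: res_simps)
  then obtain R2 where R2: "R1 = [:-a, 1:] * R2" unfolding poly_eq_0_iff_dvd by (elim dvdE)
  have cab': "b ^ q + b = a ^ q * a" using ab by (simp add: on_curve_def mult.commute)
  have bq: "b ^ (q ^ 2) + b ^ q = a ^ (q ^ 2) * a ^ q"
    using arg_cong[OF cab', of "\<lambda>z. z ^ q"]
    by (simp add: frob1_k power_mult_distrib power2_eq_square flip: power_mult)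
  have fr: "on_curve (a ^ (q ^ 2)) (b ^ (q ^ 2))"
    using arg_cong[OF bq, of "\<lambda>z. z ^ q"] arg_cong[OF ab[unfolded on_curve_def], of "\<lambda>z. z ^ (q ^ 2)"]
    by (simp add: on_curve_def frob_k power_mult_distrib mult.commute flip: power_mult)
  \<comment> \<open>The tangent passes through the Frobenius image of the point: substitute the
    curve equation at (a, b) and its q-th power.\<close>
  have "poly m (a ^ (q ^ 2)) = b - a ^ q * a + a ^ (q ^ 2) * a ^ q"
    by (simp add: m_def algebra_simps)
  also have "\<dots> = b ^ (q ^ 2)" unfolding cab'[symmetric] bq[symmetric] by simp
  finally have res_l: "res (a ^ (q ^ 2)) (b ^ (q ^ 2)) [:- m, 1:] = 0" by (simp add: res_simps)
  have "poly R (a ^ (q ^ 2)) = 0"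
  proof -
    interpret fr: discrete_valuation \<iota> "vP (a ^ (q ^ 2)) (b ^ (q ^ 2))"
      by standard (use hom dval_vP[OF fr] in auto)
    have "vge (vP (a ^ (q ^ 2)) (b ^ (q ^ 2))) 1 l"
      using vge_vP_ev(2)[OF fr] res_l l_ev by simp
    from fr.vge_power[OF this, of 2] have "vge (vP (a ^ (q ^ 2)) (b ^ (q ^ 2))) 1 (l ^ 2)"
      by (rule vge_mono) simp
    from fr.vge_mult[OF reg[OF fr] this] have "vge (vP (a ^ (q ^ 2)) (b ^ (q ^ 2))) 1 (ev P)"
      using nr P(2) by (simp add: Q_def)
    then have "res (a ^ (q ^ 2)) (b ^ (q ^ 2)) P = 0" using vge_vP_ev(2)[OF fr] by simp
    moreover have "res (a ^ (q ^ 2)) (b ^ (q ^ 2)) P = poly R (a ^ (q ^ 2))"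
      unfolding P' res_simps(3,4) res_l by (simp add: res_simps)
    ultimately show ?thesis by simp
  qed
  then have "poly R2 (a ^ (q ^ 2)) = 0" using nr unfolding R1 R2 by simp
  then obtain R3 where R3: "R2 = [:-(a ^ (q ^ 2)), 1:] * R3" unfolding poly_eq_0_iff_dvd by (elim dvdE)
  have "R3 \<noteq> 0" using \<open>R \<noteq> 0\<close> unfolding R1 R2 R3 by auto
  then have "degree R = 3 + degree R3" unfolding R1 R2 R3 by (simp add: degree_mult_eq del: mult_pCons_left)
  then show False using degR by simp
qed

lemma stabilizer_of_infinity:
  assumes \<sigma>: "\<sigma> \<in> Aut" and place: "vinf \<circ> inv \<sigma> = vinf"
  obtains \<alpha> \<beta> where "\<sigma> x = \<iota> \<alpha> * x + \<iota> \<beta>" "\<alpha> \<noteq> 0" "\<alpha> ^ (q ^ 2) = \<alpha>" "\<beta> ^ (q ^ 2) = \<beta>"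
proof -
  note \<sigma>' = AutD[OF \<sigma>]
  have vs: "vinf (\<sigma> f) = vinf f" for f
    using fun_cong[OF place, of "\<sigma> f"] \<sigma>'(1) by (simp add: bij_is_inj)
  have reg: "vge (vP a b) 0 (\<sigma> x)" "vge (vP a b) 0 (\<sigma> y)" if "on_curve a b" for a b
    using regular_elsewhere[OF \<sigma> dval_vP[OF that]] place vinf_neq_vP[OF that] by auto
  obtain P where P: "degree P < q" "\<sigma> x = ev P" using regular_imp_polynomial reg(1) by blast
  obtain P' where P': "degree P' < q" "\<sigma> y = ev P'" using regular_imp_polynomial reg(2) by blast
  have "vge vinf (- int q) (ev P)" "vge vinf (- int (q + 1)) (ev P')"
    using vs[of x] vs[of y] vinf_xy P P' by (auto simp: vge_def)
  note bound = pole_order_bound[OF P(1) this(1)] and bound' = pole_order_bound[OF P'(1) this(2)]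
  define \<alpha> \<beta> \<gamma> \<delta> \<epsilon> where coeff_defs: "\<alpha> = coeff (coeff P 0) 1" "\<beta> = coeff (coeff P 0) 0"
    "\<gamma> = coeff (coeff P' 1) 0" "\<delta> = coeff (coeff P' 0) 1" "\<epsilon> = coeff (coeff P' 0) 0"
  have deg: "degree c \<le> 1" if "q * degree c \<le> q + 1" for c :: "'k poly"
  proof (rule ccontr)
    assume "\<not> degree c \<le> 1"
    then have "q * 2 \<le> q * degree c" by (intro mult_left_mono) auto
    then show False using that q_ge_3 by linarith
  qed
  have lin: "c = [:coeff c 0, coeff c 1:]" if "degree c \<le> 1" for c :: "'k poly"
    using that by (intro poly_eq_linear coeff_eq_0) simp
  have "coeff P i = 0" if "1 \<le> i" for i
  proof (rule ccontr)
    assume "coeff P i \<noteq> 0"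
    from bound[OF this] have "(q + 1) * i \<le> q" by simp
    moreover have "(q + 1) * 1 \<le> (q + 1) * i" using that by (rule mult_left_mono) simp
    ultimately show False by simp
  qed
  then have P0: "P = [:coeff P 0:]" by (rule poly_eq_const)
  have "coeff P 0 = [:\<beta>, \<alpha>:]"
    using bound[of 0] deg[of "coeff P 0"] lin[of "coeff P 0"] by (cases "coeff P 0 = 0") (auto simp: coeff_defs)
  then have sx: "\<sigma> x = \<iota> \<alpha> * x + \<iota> \<beta>"
    unfolding P(2) by (subst P0) (simp add: eval2_const map_poly_pCons algebra_simps)
  have "coeff P' i = 0" if "2 \<le> i" for i
  proof (rule ccontr)
    assume "coeff P' i \<noteq> 0"
    from bound'[OF this] have "(q + 1) * i \<le> q + 1" by simp
    moreover have "(q + 1) * 2 \<le> (q + 1) * i" using that by (rule mult_left_mono) simp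
    ultimately show False by simp
  qed
  then have P0': "P' = [:coeff P' 0, coeff P' 1:]" by (rule poly_eq_linear)
  have "coeff P' 0 = [:\<epsilon>, \<delta>:]"
    using bound'[of 0] deg[of "coeff P' 0"] lin[of "coeff P' 0"] by (cases "coeff P' 0 = 0") (auto simp: coeff_defs)
  moreover have "coeff P' 1 = [:\<gamma>:]"
  proof (cases "coeff P' 1 = 0")
    case False
    then have "degree (coeff P' 1) = 0" using bound'[of 1] q_ge_3 by auto
    then show ?thesis unfolding coeff_defs by (metis degree_eq_zeroE coeff_pCons_0)
  qed (simp add: coeff_defs)
  ultimately have sy: "\<sigma> y = \<iota> \<gamma> * y + \<iota> \<delta> * x + \<iota> \<epsilon>"
    unfolding P'(2) by (subst P0') (simp add: ev_simps map_poly_pCons algebra_simps)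
  have \<alpha>0: "\<alpha> \<noteq> 0"
  proof
    assume "\<alpha> = 0"
    then have "\<sigma> x = \<sigma> (\<iota> \<beta>)" using sx \<sigma>'(3) by simp
    then show False using \<sigma>'(1) x_not_const by (metis bij_is_inj injD)
  qed
  have rel: "\<sigma> y ^ q + \<sigma> y = \<sigma> x ^ (q + 1)"
    using arg_cong[OF curve, of \<sigma>] by (simp only: is_ring_hom_simps[OF \<sigma>'(2)])
  have yq: "y ^ q = x ^ (q + 1) - y" using curve by (simp add: eq_diff_eq)
  \<comment> \<open>The curve equation for the images, with y^q replaced by x^(q+1) - y:
    \<open>c\<close> is its part free of y, and \<gamma> - \<gamma>^q is the coefficient of y. Both
    vanish because 1 and y are independent over K[x].\<close>
  define c where "c = monom (\<gamma> ^ q - \<alpha> ^ (q + 1)) (q + 1) + monom (\<delta> ^ q - \<alpha> ^ q * \<beta>) q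
    + [:\<epsilon> ^ q + \<epsilon> - \<beta> ^ (q + 1), \<delta> - \<alpha> * \<beta> ^ q:]"
  have "ev [:c, [:\<gamma> - \<gamma> ^ q:]:] = \<sigma> y ^ q + \<sigma> y - \<sigma> x ^ (q + 1)"
    unfolding ev_simps(1,8) c_def px_simps(3) sx sy
    by (simp add: map_poly_monom poly_monom map_poly_pCons frob1_f power_mult_distrib yq algebra_simps)
  then have "[:c, [:\<gamma> - \<gamma> ^ q:]:] = 0"
    using rel q_ge_3 by (intro eval2_eq_0_small_degree) auto
  then have "c = 0" "\<gamma> = \<gamma> ^ q" by auto
  then have "coeff c (q + 1) = 0" "coeff c q = 0" "coeff c 1 = 0" by auto
  then have 1: "\<gamma> ^ q = \<alpha> ^ (q + 1)" "\<delta> ^ q = \<alpha> ^ q * \<beta>" "\<delta> = \<alpha> * \<beta> ^ q"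
    using q_ge_3 by (auto simp: c_def coeff_pCons split: nat.splits)
  have "(\<alpha> ^ (q + 1)) ^ q = \<alpha> ^ (q + 1)" using 1(1) \<open>\<gamma> = \<gamma> ^ q\<close> by metis
  then have "\<alpha> ^ (q ^ 2) * \<alpha> ^ q = \<alpha> * \<alpha> ^ q"
    by (simp add: power_mult_distrib power2_eq_square flip: power_mult)
  then have a: "\<alpha> ^ (q ^ 2) = \<alpha>" using \<alpha>0 by simp
  \<comment> \<open>The q-th power of \<delta> = \<alpha> \<beta>^q, compared with \<delta>^q =
    \<alpha>^q \<beta>.\<close>
  have "\<alpha> ^ q * \<beta> ^ (q ^ 2) = \<alpha> ^ q * \<beta>"
    using 1(2,3) by (simp add: power_mult_distrib power2_eq_square power_mult)
  then have "\<beta> ^ (q ^ 2) = \<beta>" using \<alpha>0 by simp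
  then show ?thesis using that[OF sx \<alpha>0 a] by blast
qed

end

section \<open>Invariance of the generator\<close>

text \<open>The determinant with rows (x_i), (y_i) and (1, 1, 1) after subtraction of the first
  column; it tests whether three points are collinear.\<close>

definition det_lines :: "'a::comm_ring_1 \<Rightarrow> 'a \<Rightarrow> 'a \<Rightarrow> 'a \<Rightarrow> 'a \<Rightarrow> 'a \<Rightarrow> 'a" where
  "det_lines x0 x1 x2 y0 y1 y2 = (x1 - x0) * (y2 - y0) - (x2 - x0) * (y1 - y0)"

lemma hermitian_t_altdef:
  "hermitian_t q X Y =
     (Y + Y ^ (q ^ 5) - X ^ (q ^ 5) * X) / (Y + Y ^ (q ^ 3) - X ^ (q ^ 3) * X) *
     (det_lines X (X ^ (q ^ 2)) (X ^ (q ^ 6)) Y (Y ^ (q ^ 2)) (Y ^ (q ^ 6)) /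
      det_lines X (X ^ (q ^ 4)) (X ^ (q ^ 6)) Y (Y ^ (q ^ 4)) (Y ^ (q ^ 6))) ^ q"
  unfolding hermitian_t_def det_3 vector_3 det_lines_def by (simp add: algebra_simps)

lemma hom_hermitian_t:
  assumes "is_ring_hom \<sigma>"
  shows "\<sigma> (hermitian_t q X Y) = hermitian_t q (\<sigma> X) (\<sigma> Y)"
  unfolding hermitian_t_altdef det_lines_def
  by (simp only: is_ring_hom_simps[OF assms] is_ring_hom_field_simps[OF assms])

text \<open>Multiplying the columns by y0, y1, y2 leaves the original determinant with its last two
  rows exchanged; hence the sign.\<close>

lemma det_lines_inversion:
  fixes x0 :: "'a::field"
  assumes "y0 \<noteq> 0" "y1 \<noteq> 0" "y2 \<noteq> 0"
  shows "det_lines (x0 / y0) (x1 / y1) (x2 / y2) (1 / y0) (1 / y1) (1 / y2)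
    = - det_lines x0 x1 x2 y0 y1 y2 / (y0 * y1 * y2)"
  using assms by (simp add: det_lines_def field_simps)

text \<open>The variables with index i stand for the q^i-th powers of x, y and w, and the recursion
  for Y is the curve equation under Frobenius. Once all later Y are eliminated, these are polynomial
  identities in independent variables.\<close>

lemma frobenius_identities:
  fixes X0 :: "'a::comm_ring_1"
  assumes "Y1 = X1 * X0 - Y0" "Y2 = X2 * X1 - Y1" "Y3 = X3 * X2 - Y2" "Y4 = X4 * X3 - Y3"
    "Y5 = X5 * X4 - Y4" "Y6 = X6 * X5 - Y5"
    and "W0 = X2 - X0" "W1 = X3 - X1" "W2 = X4 - X2" "W3 = X5 - X3" "W4 = X6 - X4"
  shows "Y0 + Y3 - X3 * X0 = W0 * W1"
    "Y0 + Y5 - X5 * X0 = W0 * W1 + W0 * W3 + W2 * W3"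
    "det_lines X0 X2 X6 Y0 Y2 Y6 = W0 * (W1 * W2 + W1 * W4 + W3 * W4)"
    "det_lines X0 X4 X6 Y0 Y4 Y6 = W4 * (W0 * W1 + W0 * W3 + W2 * W3)"
  by (simp_all add: assms det_lines_def algebra_simps)

section \<open>The functions w, u and t, and the invariance of t\<close>

context hermitian
begin

text \<open>As a polynomial in x it has the elements of F_(q^2) as roots. So shifts of x by F_(q^2)
  fix it, and scaling x by c in F_(q^2) multiplies it by c; the exponent q^2 - 1 in \<open>u\<close>
  removes this factor.\<close>

definition w :: 'f where "w = x ^ (q ^ 2) - x"
definition u :: 'f where "u = w ^ (q ^ 2 - 1)"
definition t :: 'f where "t = hermitian_t q x y"

lemma q2_gt_1: "q ^ 2 > 1" using one_less_power[of q 2] q_ge_3 by simp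

lemma w_px: "w = px (monom 1 (q ^ 2) - monom 1 1)"
  unfolding w_def px_simps by (simp add: map_poly_monom poly_monom)

lemma degree_w: "degree (monom 1 (q ^ 2) - monom 1 1 :: 'k poly) = q ^ 2"
  unfolding diff_conv_add_uminus using q2_gt_1
  by (subst degree_add_eq_left) (auto simp: degree_monom_eq)

lemma w_neq_0: "w \<noteq> 0"
  using degree_w q2_gt_1 unfolding w_px px_eq_0_iff by auto

lemma u_px: "u = px ((monom 1 (q ^ 2) - monom 1 1) ^ (q ^ 2 - 1))"
  unfolding u_def w_px px_simps ..

lemma u_neq_0: "u \<noteq> 0" using w_neq_0 by (simp add: u_def)

lemma w_u: "w ^ (q ^ i) * u ^ (q ^ i) = w ^ (q ^ (i + 2))"
proof -
  have "w * u = w ^ (q ^ 2)" unfolding u_def using q2_gt_1 by (metis power_eq_if not_one_less_zero)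
  then have "(w * u) ^ (q ^ i) = w ^ (q ^ (i + 2))"
    by (simp add: power_add power2_eq_square mult_ac flip: power_mult)
  then show ?thesis by (simp add: power_mult_distrib)
qed

lemma frob_power: "(a ^ (q ^ i)) ^ q = (a :: 'f) ^ (q ^ (i + 1))"
  by (simp add: mult.commute flip: power_mult)

lemma frob_power_1: "(a ^ q) ^ q = (a :: 'f) ^ (q ^ 2)"
  by (simp add: power2_eq_square power_mult)

lemma frobenius_y: "y ^ (q ^ (i + 1)) = x ^ (q ^ (i + 1)) * x ^ (q ^ i) - y ^ (q ^ i)"
proof -
  have "y ^ q = x ^ q * x - y" using curve by (simp add: eq_diff_eq mult.commute)
  then have "(y ^ q) ^ (q ^ i) = (x ^ q) ^ (q ^ i) * x ^ (q ^ i) - y ^ (q ^ i)"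
    by (simp add: frob_f power_mult_distrib)
  then show ?thesis by (simp flip: power_mult)
qed

lemma frobenius_w: "w ^ (q ^ i) = x ^ (q ^ (i + 2)) - x ^ (q ^ i)"
  unfolding w_def by (simp add: frob_f power_add power2_eq_square mult_ac flip: power_mult)

text \<open>The two determinants are w A^q and w^(q^4) A, and A = w w^q n. The outer power q in t
  turns w^(q^2) / w^(q^4) into w^(q^3) / w^(q^5) = 1 / u^(q^3), and the powers of n collect to q^2 -
  q + 1.\<close>

lemma t_eq: "t = (1 + u ^ q + u ^ (q + 1)) ^ (q ^ 2 - q + 1) / u ^ (q ^ 3)"
proof -
  define n where "n = 1 + u ^ q + u ^ (q + 1)"
  define A where "A = w * w ^ q + w * w ^ (q ^ 3) + w ^ (q ^ 2) * w ^ (q ^ 3)"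
  have Y: "y ^ q = x ^ q * x - y" "y ^ (q ^ 2) = x ^ (q ^ 2) * x ^ q - y ^ q" "y ^ (q ^ 3) = x ^ (q ^ 3) * x ^ (q ^ 2) - y ^ (q ^ 2)"
    "y ^ (q ^ 4) = x ^ (q ^ 4) * x ^ (q ^ 3) - y ^ (q ^ 3)" "y ^ (q ^ 5) = x ^ (q ^ 5) * x ^ (q ^ 4) - y ^ (q ^ 4)" "y ^ (q ^ 6) = x ^ (q ^ 6) * x ^ (q ^ 5) - y ^ (q ^ 5)"
    using frobenius_y[of 0] frobenius_y[of 1] frobenius_y[of 2] frobenius_y[of 3] frobenius_y[of 4] frobenius_y[of 5]
    by (simp_all add: numeral_eq_Suc)
  have W: "w = x ^ (q ^ 2) - x" "w ^ q = x ^ (q ^ 3) - x ^ q" "w ^ (q ^ 2) = x ^ (q ^ 4) - x ^ (q ^ 2)"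
    "w ^ (q ^ 3) = x ^ (q ^ 5) - x ^ (q ^ 3)" "w ^ (q ^ 4) = x ^ (q ^ 6) - x ^ (q ^ 4)"
    using frobenius_w[of 0] frobenius_w[of 1] frobenius_w[of 2] frobenius_w[of 3] frobenius_w[of 4]
    by (simp_all add: numeral_eq_Suc)
  note id = frobenius_identities[OF Y W]
  have Aq: "A ^ q = w ^ q * w ^ (q ^ 2) + w ^ q * w ^ (q ^ 4) + w ^ (q ^ 3) * w ^ (q ^ 4)"
    using frob_power_1[of w] frob_power[of w 2] frob_power[of w 3]
    by (simp add: A_def frob1_f power_mult_distrib)
  have t1: "t = A / (w * w ^ q) * (w * A ^ q / (w ^ (q ^ 4) * A)) ^ q"
    unfolding t_def hermitian_t_altdef id Aq[symmetric] A_def[symmetric] ..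
  have w2: "w ^ (q ^ 2) = w * u" and w3: "w ^ (q ^ 3) = w ^ q * u ^ q" and w5: "w ^ (q ^ 5) = w ^ (q ^ 3) * u ^ (q ^ 3)"
    using w_u[of 0] w_u[of 1] w_u[of 3] by (simp_all add: numeral_eq_Suc)
  have A: "A = w * w ^ q * n"
    unfolding A_def n_def w2 w3 by (simp add: algebra_simps)
  \<comment> \<open>For n = 0 both sides are 0, since then A = 0 and the exponent q^2 - q + 1 is
    positive; so the case needs no cancellation.\<close>
  show ?thesis
  proof (cases "n = 0")
    case True
    then show ?thesis unfolding n_def[symmetric] t1 A by simp
  next
    case False
    have nq: "n ^ (q ^ 2) = n ^ (q ^ 2 - q) * n ^ q"
      using q_ge_3 by (simp add: power2_eq_square flip: power_add)
    have "w * A ^ q / (w ^ (q ^ 4) * A) = w ^ (q ^ 2) * n ^ q / (w ^ (q ^ 4) * n)"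
      using frob_power_1[of w] w_neq_0 False unfolding A by (simp add: power_mult_distrib field_simps)
    then have "(w * A ^ q / (w ^ (q ^ 4) * A)) ^ q = w ^ (q ^ 3) * n ^ (q ^ 2) / (w ^ (q ^ 5) * n ^ q)"
      using frob_power[of w 2] frob_power[of w 4] frob_power_1[of n]
      by (simp add: power_mult_distrib power_divide)
    also have "\<dots> = n ^ (q ^ 2 - q) / u ^ (q ^ 3)"
      unfolding w5 nq using w_neq_0 False by simp
    finally show ?thesis unfolding n_def[symmetric] t1 using w_neq_0 by (simp add: A mult.commute)
  qed
qed

lemma affine_fixes_u:
  assumes \<sigma>: "\<sigma> \<in> Aut" and x: "\<sigma> x = \<iota> \<alpha> * x + \<iota> \<beta>"
    and "\<alpha> \<noteq> 0" "\<alpha> ^ (q ^ 2) = \<alpha>" "\<beta> ^ (q ^ 2) = \<beta>"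
  shows "\<sigma> w = \<iota> \<alpha> * w" "\<sigma> u = u" "\<sigma> t = t"
proof -
  note simps = is_ring_hom_simps[OF AutD(2)[OF \<sigma>]]
  have "\<sigma> w = \<iota> (\<alpha> ^ (q ^ 2)) * x ^ (q ^ 2) + \<iota> (\<beta> ^ (q ^ 2)) - (\<iota> \<alpha> * x + \<iota> \<beta>)"
    unfolding w_def simps x by (simp add: frob_f power_mult_distrib)
  then show w: "\<sigma> w = \<iota> \<alpha> * w" using assms(4,5) by (simp add: w_def algebra_simps)
  have "\<alpha> * \<alpha> ^ (q ^ 2 - 1) = \<alpha>" using assms(4) q2_gt_1 by (metis power_eq_if not_one_less_zero)
  then have "\<iota> (\<alpha> ^ (q ^ 2 - 1)) = 1" using assms(3) by simp
  then show u: "\<sigma> u = u" unfolding u_def simps w by (simp add: power_mult_distrib)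
  show "\<sigma> t = t" unfolding t_eq using u
    by (simp only: simps is_ring_hom_field_simps[OF AutD(2)[OF \<sigma>]])
qed

text \<open>The first quotient picks up y^(q^3) / y^(q^5), the determinants y^(q^4) / y^(q^2). The
  exponent q on the latter is exactly what makes the two cancel.\<close>

lemma J_fixes_t: "J t = t"
proof -
  define A5 where "A5 = y + y ^ (q ^ 5) - x ^ (q ^ 5) * x"
  define A3 where "A3 = y + y ^ (q ^ 3) - x ^ (q ^ 3) * x"
  define D1 where "D1 = det_lines x (x ^ (q ^ 2)) (x ^ (q ^ 6)) y (y ^ (q ^ 2)) (y ^ (q ^ 6))"
  define D2 where "D2 = det_lines x (x ^ (q ^ 4)) (x ^ (q ^ 6)) y (y ^ (q ^ 4)) (y ^ (q ^ 6))"
  have inv: "1 / y + 1 / z - a / z * (x / y) = (y + z - a * x) / (y * z)" if "z \<noteq> 0" for a z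
    using that y_neq_0 by (simp add: field_simps)
  have nz: "y ^ n \<noteq> 0" for n using y_neq_0 by simp
  have "J t = hermitian_t q (x / y) (1 / y)"
    unfolding t_def hom_hermitian_t[OF AutD(2)[OF J(1)]] J ..
  also have "\<dots> = A5 / (y * y ^ (q ^ 5)) / (A3 / (y * y ^ (q ^ 3))) *
      (- D1 / (y * y ^ (q ^ 2) * y ^ (q ^ 6)) / (- D2 / (y * y ^ (q ^ 4) * y ^ (q ^ 6)))) ^ q"
    unfolding hermitian_t_altdef power_divide[of x] power_divide[of 1] power_one
      inv[OF nz] det_lines_inversion[OF y_neq_0 nz nz] A5_def A3_def D1_def D2_def ..
  also have "A5 / (y * y ^ (q ^ 5)) / (A3 / (y * y ^ (q ^ 3))) = A5 / A3 * (y ^ (q ^ 3) / y ^ (q ^ 5))"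
    using y_neq_0 by simp
  also have "- D1 / (y * y ^ (q ^ 2) * y ^ (q ^ 6)) / (- D2 / (y * y ^ (q ^ 4) * y ^ (q ^ 6)))
      = D1 / D2 * (y ^ (q ^ 4) / y ^ (q ^ 2))"
    using y_neq_0 by simp
  also have "\<dots> ^ q = (D1 / D2) ^ q * (y ^ (q ^ 5) / y ^ (q ^ 3))"
    using frob_power[of y 4] frob_power[of y 2] by (simp add: power_divide power_mult_distrib)
  also have "A5 / A3 * (y ^ (q ^ 3) / y ^ (q ^ 5)) * ((D1 / D2) ^ q * (y ^ (q ^ 5) / y ^ (q ^ 3))) = A5 / A3 * (D1 / D2) ^ q"
    using y_neq_0 by simp
  finally show ?thesis
    unfolding t_def hermitian_t_altdef A5_def A3_def D1_def D2_def .
qed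

text \<open>The images \<rho> x and \<rho> y under the inverse translation vanish at (a, b), so
  composition with \<rho> moves the centre to the origin; composition with \<open>J\<close> then
  gives \<open>vinf\<close> by its definition.\<close>

lemma moves_to_infinity:
  assumes ab: "on_curve a b" and a: "a ^ (q ^ 2) = a"
  shows "\<exists>\<tau>\<in>Aut. vP a b \<circ> \<tau> = vinf \<and> \<tau> t = t"
proof -
  note ab' = on_curve_inverse[OF ab a]
  obtain \<rho> where \<rho>: "\<rho> \<in> Aut" "\<rho> x = x + \<iota> (- a)" "\<rho> y = y + \<iota> ((- a) ^ q) * x + \<iota> (b ^ q)"
    using translation_exists[OF ab'] by blast
  have "\<rho> x = ev [:[:-a, 1:]:]" "\<rho> y = ev [:[:b ^ q, - (a ^ q):], 1:]"
    unfolding \<rho>(2,3) by (simp_all add: ev_simps map_poly_pCons frob1_k algebra_simps)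
  moreover have "res a b [:[:-a, 1:]:] = 0" "res a b [:[:b ^ q, - (a ^ q):], 1:] = 0"
    using ab by (simp_all add: res_simps on_curve_def algebra_simps)
  ultimately have "centered (vP a b \<circ> \<rho>) 0 0"
    using vge_vP_ev(2)[OF ab] by (simp add: centered_def vge_comp[OF \<rho>(1)])
  then have "vP a b \<circ> \<rho> = vP 0 0"
    by (intro centered_unique on_curve_0 dval_comp dval_vP ab \<rho>(1))
  then have "vP a b \<circ> (\<rho> \<circ> J) = vinf" by (simp add: vinf_def comp_assoc[symmetric])
  moreover have "\<rho> t = t"
    using affine_fixes_u(3)[OF \<rho>(1), of 1 "- a"] \<rho>(2) ab'(2) by simp
  then have "(\<rho> \<circ> J) t = t" using J_fixes_t by simp
  ultimately show ?thesis using Aut_comp[OF \<rho>(1) J(1)] by blast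
qed

lemma Aut_fixes_t:
  assumes \<sigma>: "\<sigma> \<in> Aut"
  shows "\<sigma> t = t"
proof -
  define v where "v = vinf \<circ> inv \<sigma>"
  have v: "dval \<iota> v" unfolding v_def by (intro dval_comp dval_vinf Aut_inv \<sigma>)
  have fixed: "\<tau> t = t" if \<tau>: "\<tau> \<in> Aut" "vinf \<circ> inv \<tau> = vinf" for \<tau>
    using stabilizer_of_infinity[OF \<tau>] affine_fixes_u(3)[OF \<tau>(1)] by metis
  show ?thesis
  proof (cases "v x < 0")
    case True
    show ?thesis by (rule fixed[OF \<sigma>]) (use negative_unique[OF v True] in \<open>unfold v_def\<close>)
  next
    case False
    then obtain a b where ab: "on_curve a b" "v = vP a b"
      using center_exists[OF v] by (auto simp: vge_def)
    have "a ^ (q ^ 2) = a" using image_of_infinity_rational[OF \<sigma> ab(1)] ab(2) unfolding v_def .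
    then obtain \<tau> where \<tau>: "\<tau> \<in> Aut" "vP a b \<circ> \<tau> = vinf" "\<tau> t = t"
      using moves_to_infinity[OF ab(1)] by blast
    \<comment> \<open>The composite \<open>inv \<tau> \<circ> \<sigma>\<close> fixes infinity, since
      its place is \<open>v \<circ> \<tau>\<close>.\<close>
    have "inv (inv \<tau> \<circ> \<sigma>) = inv \<sigma> \<circ> \<tau>"
      using AutD(1)[OF \<sigma>] AutD(1)[OF \<tau>(1)]
      by (simp add: o_inv_distrib bij_imp_bij_inv inv_inv_eq)
    then have "vinf \<circ> inv (inv \<tau> \<circ> \<sigma>) = v \<circ> \<tau>" by (simp add: v_def comp_assoc)
    then have "vinf \<circ> inv (inv \<tau> \<circ> \<sigma>) = vinf" using \<tau>(2) ab(2) by simp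
    then have "inv \<tau> (\<sigma> t) = t" using fixed[OF Aut_comp[OF Aut_inv[OF \<tau>(1)] \<sigma>]] by simp
    then have "\<sigma> t = \<tau> t" using AutD(1)[OF \<tau>(1)] by (metis bij_inv_eq_iff)
    then show ?thesis using \<tau>(3) by simp
  qed
qed

end

section \<open>The fixed field\<close>

lemma image_eq_imageI:
  assumes "\<And>a. a \<in> A \<Longrightarrow> \<exists>b\<in>B. f a = g b" "\<And>b. b \<in> B \<Longrightarrow> \<exists>a\<in>A. f a = g b"
  shows "f ` A = g ` B"
  unfolding image_def using assms by (intro Collect_cong) metis

context hermitian
begin

abbreviation K :: "'f \<Rightarrow> 'f set" where "K \<alpha> \<equiv> field_adjoin \<iota> {\<alpha>}"

text \<open>The second alternative for \<open>f\<close> serves the step down to K(x), where the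
  large field is known as K(x)[y] and not as K(\<alpha>) for a single \<alpha>.\<close>

lemma descent:
  assumes m: "coeffs_in (K \<beta>) m" "degree m > 0" "poly m \<alpha> = 0"
    and S: "S \<subseteq> Aut" "\<And>\<sigma>. \<sigma> \<in> S \<Longrightarrow> \<sigma> \<beta> = \<beta>"
    and card: "degree m \<le> card ((\<lambda>\<sigma>. \<sigma> \<alpha>) ` S)"
    and f: "f \<in> K \<alpha> \<or> f \<in> simple_ext (K \<beta>) \<alpha>" "\<And>\<sigma>. \<sigma> \<in> S \<Longrightarrow> \<sigma> f = f"
  shows "f \<in> K \<beta>"
proof -
  note k = is_subfield_field_adjoin[of \<iota> "{\<beta>}"]
  have "m \<noteq> 0" using m(2) by auto
  have "K \<alpha> \<subseteq> simple_ext (K \<beta>) \<alpha>"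
    using simple_ext_contains[OF k] field_adjoin_base[of \<iota> _ "{\<beta>}"]
    by (intro field_adjoin_minimal is_subfield_simple_ext[OF k m(1) \<open>m \<noteq> 0\<close> m(3)]) auto
  then have "f \<in> simple_ext (K \<beta>) \<alpha>" using f(1) by blast
  moreover have "\<sigma> c = c" if "\<sigma> \<in> S" "c \<in> K \<beta>" for \<sigma> c
    using hom_eq_on_field_adjoin[of \<sigma> id \<iota> "{\<beta>}" c] AutD[of \<sigma>] S that
    by (auto simp: is_ring_hom_def)
  ultimately show ?thesis
    using fixed_in_base_field[OF k m(1) \<open>m \<noteq> 0\<close> m(3) _ _ card] S AutD(2) f(2) by blast
qed

section \<open>The descent from K(x, y) to K(x), K(w) and K(u)\<close>

lemma fibre_nonempty: "\<exists>b. on_curve a b"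
  using card_fibre[of a] q_ge_3 by (metis Collect_empty_eq card.empty not_numeral_le_zero)

lemma affine_fixes_w:
  assumes "\<sigma> \<in> Aut" "\<sigma> x = x + \<iota> a" "a ^ (q ^ 2) = a"
  shows "\<sigma> w = w"
  using affine_fixes_u(1)[OF assms(1), of 1 a] assms(2,3) by simp

lemma scaling_fixes_u:
  assumes "\<sigma> \<in> Aut" "\<sigma> x = \<iota> c * x" "c \<noteq> 0" "c ^ (q ^ 2) = c"
  shows "\<sigma> w = \<iota> c * w" "\<sigma> u = u"
  using affine_fixes_u(1,2)[OF assms(1), of c 0] assms(2-4) q_ge_3 by (auto simp: power_0_left)

lemma fixed_in_K_x:
  assumes f: "\<And>\<sigma>. \<sigma> \<in> Aut \<Longrightarrow> \<sigma> f = f"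
  shows "f \<in> K x"
proof (rule descent[OF y_algebraic(1) _ y_algebraic(3)])
  \<comment> \<open>Translations with a = 0 fix x and move y by the q roots of b^q + b = 0.\<close>
  let ?S = "{\<sigma> \<in> Aut. \<exists>b. on_curve 0 b \<and> \<sigma> x = x \<and> \<sigma> y = y + \<iota> b}"
  have "\<exists>\<sigma>\<in>?S. \<sigma> y = y + \<iota> b" if b: "on_curve 0 b" for b
    using translation_exists[OF b] q_ge_3 b by (auto simp: power_0_left)
  then have "(\<lambda>\<sigma>. \<sigma> y) ` ?S = (\<lambda>b. y + \<iota> b) ` {b. on_curve 0 b}"
    by (auto simp: image_iff) metis
  then have "card ((\<lambda>\<sigma>. \<sigma> y) ` ?S) = q"
    using card_image[of "\<lambda>b. y + \<iota> b" "{b. on_curve 0 b}"] card_fibre[of 0] by (simp add: inj_on_def)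
  then show "degree (monom 1 q + monom 1 1 - [:x ^ (q + 1):]) \<le> card ((\<lambda>\<sigma>. \<sigma> y) ` ?S)"
    unfolding y_algebraic(2) by simp
  show "0 < degree (monom 1 q + monom 1 1 - [:x ^ (q + 1):])"
    unfolding y_algebraic(2) using q_ge_3 by simp
qed (use simple_ext_y f in auto)

lemma fixed_in_K_w:
  assumes f: "\<And>\<sigma>. \<sigma> \<in> Aut \<Longrightarrow> \<sigma> f = f"
  shows "f \<in> K w"
proof (rule descent)
  let ?m = "monom 1 (q ^ 2) - monom 1 1 - [:w:]"
  have "w \<in> K w" by (simp add: field_adjoin_gen)
  then show "coeffs_in (K w) ?m"
    by (intro coeffs_in_intros is_subfieldD is_subfield_field_adjoin)
  have deg: "degree ?m = q ^ 2"
    unfolding diff_conv_add_uminus add.assoc using q2_gt_1 q_ge_3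
    by (subst degree_add_eq_left)
       (auto simp: degree_monom_eq intro!: degree_diff_less le_less_trans[OF degree_monom_le])
  then show "0 < degree ?m" using q2_gt_1 by linarith
  show "poly ?m x = 0" by (simp add: poly_monom w_def)
  let ?S = "{\<sigma> \<in> Aut. \<exists>a. a ^ (q ^ 2) = a \<and> \<sigma> x = x + \<iota> a}"
  have "\<exists>\<sigma>\<in>?S. \<sigma> x = x + \<iota> a" if "a ^ (q ^ 2) = a" for a
    using fibre_nonempty[of a] translation_exists[of a] that by blast
  then have "(\<lambda>\<sigma>. \<sigma> x) ` ?S = (\<lambda>a. x + \<iota> a) ` {a. a ^ (q ^ 2) = a}"
    by (auto simp: image_iff) metis
  then have "card ((\<lambda>\<sigma>. \<sigma> x) ` ?S) = q ^ 2"
    using card_image[of "\<lambda>a. x + \<iota> a" "{a. a ^ (q ^ 2) = a}"] card_Fq2 by (simp add: inj_on_def)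
  then show "degree ?m \<le> card ((\<lambda>\<sigma>. \<sigma> x) ` ?S)" using deg by simp
  show "\<sigma> w = w" if "\<sigma> \<in> ?S" for \<sigma> using affine_fixes_w that by blast
qed (use fixed_in_K_x f in auto)

lemma fixed_in_K_u:
  assumes f: "\<And>\<sigma>. \<sigma> \<in> Aut \<Longrightarrow> \<sigma> f = f"
  shows "f \<in> K u"
proof (rule descent)
  let ?m = "monom 1 (q ^ 2 - 1) - [:u:]"
  have "u \<in> K u" by (simp add: field_adjoin_gen)
  then show "coeffs_in (K u) ?m"
    by (intro coeffs_in_intros is_subfieldD is_subfield_field_adjoin)
  have deg: "degree ?m = q ^ 2 - 1"
    unfolding diff_conv_add_uminus using q2_gt_1
    by (subst degree_add_eq_left) (auto simp: degree_monom_eq)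
  then show "0 < degree ?m" using q2_gt_1 by linarith
  show "poly ?m w = 0" by (simp add: poly_monom u_def)
  let ?C = "{c. c ^ (q ^ 2) = c} - {0 :: 'k}"
  let ?S = "{\<sigma> \<in> Aut. \<exists>c\<in>?C. \<sigma> x = \<iota> c * x}"
  have conj: "\<exists>\<sigma>\<in>?S. \<sigma> w = \<iota> c * w" if c: "c \<in> ?C" for c
  proof -
    obtain \<sigma> where "\<sigma> \<in> Aut" "\<sigma> x = \<iota> c * x" using scaling_exists[of c] c by blast
    then show ?thesis using scaling_fixes_u(1)[of \<sigma> c] c by auto
  qed
  have "\<exists>c\<in>?C. \<sigma> w = \<iota> c * w" if "\<sigma> \<in> ?S" for \<sigma>
    using that scaling_fixes_u(1)[of \<sigma>] by blast
  then have "(\<lambda>\<sigma>. \<sigma> w) ` ?S = (\<lambda>c. \<iota> c * w) ` ?C"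
    using conj by (rule image_eq_imageI)
  then have "card ((\<lambda>\<sigma>. \<sigma> w) ` ?S) = card ?C"
    using card_image[of "\<lambda>c. \<iota> c * w" ?C] w_neq_0 by (simp add: inj_on_def)
  also have "\<dots> = q ^ 2 - 1" using card_Fq2 q2_gt_1 q_ge_3 by (simp add: card_Diff_singleton power_0_left)
  finally show "degree ?m \<le> card ((\<lambda>\<sigma>. \<sigma> w) ` ?S)" using deg by simp
  show "\<sigma> u = u" if "\<sigma> \<in> ?S" for \<sigma> using scaling_fixes_u(2)[of \<sigma>] that by blast
qed (use fixed_in_K_w f in auto)

section \<open>The rational points, the conjugates of u and the descent to K(t)\<close>

definition rational_points :: "('k \<times> 'k) set" where
  "rational_points = Sigma {a. a ^ (q ^ 2) = a} (\<lambda>a. {b. on_curve a b})"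

lemma rational_points: "finite rational_points" "card rational_points = q ^ 3"
proof -
  have "finite {a::'k. a ^ (q ^ 2) = a}" "finite {b. on_curve a b}" for a
    using card_Fq2 card_fibre[of a] q_ge_3 by (auto intro!: card_ge_0_finite)
  then have "finite rational_points" "card rational_points = q ^ 2 * q"
    unfolding rational_points_def by (auto simp: card_SigmaI card_fibre card_Fq2)
  then show "finite rational_points" "card rational_points = q ^ 3"
    by (simp_all add: power2_eq_square power3_eq_cube)
qed

lemma vinf_u: "vinf u < 0"
proof -
  interpret discrete_valuation \<iota> vinf by standard (use hom dval_vinf in auto)
  have "vinf w = - (int q * int (q ^ 2))" using vinf_px degree_w w_neq_0 unfolding w_px px_eq_0_iff by metis
  moreover have "0 < int q * int (q ^ 2)" using q_ge_3 by simp
  ultimately have "vinf w < 0" by simp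
  moreover have "0 < int (q ^ 2 - 1)" unfolding of_nat_0_less_iff using q2_gt_1 by (rule zero_less_diff[THEN iffD2])
  ultimately show ?thesis unfolding u_def v_power by (intro mult_pos_neg)
qed

text \<open>The conjugates of \<open>u\<close> are told apart by their poles, which are the rational places.\<close>

lemma conjugates_of_u:
  obtains S where "S \<subseteq> Aut" "card ((\<lambda>\<sigma>. \<sigma> u) ` S) = q ^ 3 + 1"
proof -
  have "\<forall>P\<in>rational_points. \<exists>\<tau>. \<tau> \<in> Aut \<and> vP (fst P) (snd P) \<circ> \<tau> = vinf"
    using moves_to_infinity by (fastforce simp: rational_points_def)
  then obtain \<tau> where \<tau>: "\<And>P. P \<in> rational_points \<Longrightarrow> \<tau> P \<in> Aut"
    "\<And>P. P \<in> rational_points \<Longrightarrow> vP (fst P) (snd P) \<circ> \<tau> P = vinf" by metis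
  have oc: "on_curve (fst P) (snd P)" if "P \<in> rational_points" for P
    using that by (auto simp: rational_points_def)
  \<comment> \<open>As a polynomial in x, u has no pole other than infinity. So the pole of
    \<open>\<tau> P u\<close> at P determines P.\<close>
  have u_regular: "vge v 0 u" if "dval \<iota> v" "v \<noteq> vinf" for v
  proof -
    interpret discrete_valuation \<iota> v by standard (use hom that in auto)
    have "vge v 0 x" using negative_unique[OF that(1)] that(2) by (force simp: vge_def)
    then show ?thesis unfolding u_px by (rule vge_poly)
  qed
  have neg: "vP (fst P) (snd P) (\<tau> P u) < 0" if "P \<in> rational_points" for P
    using fun_cong[OF \<tau>(2)[OF that], of u] vinf_u by simp
  have inj: "inj_on (\<lambda>P. \<tau> P u) rational_points"
  proof (rule inj_onI, rule ccontr)
    fix P P' assume P: "P \<in> rational_points" "P' \<in> rational_points" "\<tau> P u = \<tau> P' u" "P \<noteq> P'"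
    have "vP (fst P) (snd P) \<circ> \<tau> P' \<noteq> vinf"
    proof
      assume "vP (fst P) (snd P) \<circ> \<tau> P' = vinf"
      then have "vP (fst P) (snd P) \<circ> \<tau> P' = vP (fst P') (snd P') \<circ> \<tau> P'" using \<tau>(2)[OF P(2)] by simp
      then have "vP (fst P) (snd P) = vP (fst P') (snd P')"
        using AutD(1)[OF \<tau>(1)[OF P(2)]] by (metis bij_is_surj comp_assoc comp_id surj_iff)
      then have "P = P'" using vP_inject[OF oc[OF P(1)] oc[OF P(2)]] by (simp add: prod_eq_iff)
      then show False using P(4) by simp
    qed
    then have "vge (vP (fst P) (snd P) \<circ> \<tau> P') 0 u"
      using u_regular dval_comp[OF dval_vP[OF oc[OF P(1)]] \<tau>(1)[OF P(2)]] by blast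
    then have "vge (vP (fst P) (snd P)) 0 (\<tau> P u)" using vge_comp[OF \<tau>(1)[OF P(2)]] P(3) by simp
    \<comment> \<open>The relation \<open>vge\<close> also admits the element 0; there the default
      value 0 contradicts the negative value.\<close>
    then show False using neg[OF P(1)] vP_def by (auto simp: vge_def)
  qed
  have "u \<notin> (\<lambda>P. \<tau> P u) ` rational_points"
  proof
    assume "u \<in> (\<lambda>P. \<tau> P u) ` rational_points"
    then obtain P where P: "P \<in> rational_points" "u = \<tau> P u" by blast
    have "vge (vP (fst P) (snd P)) 0 u"
      using u_regular[OF dval_vP[OF oc[OF P(1)]]] vinf_neq_vP[OF oc[OF P(1)]] by metis
    then show False using neg[OF P(1)] P(2) u_neq_0 by (simp add: vge_def)
  qed
  moreover have "card ((\<lambda>P. \<tau> P u) ` rational_points) = q ^ 3"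
    using card_image[OF inj] rational_points(2) by simp
  ultimately have "card (insert u ((\<lambda>P. \<tau> P u) ` rational_points)) = q ^ 3 + 1"
    using rational_points(1) by simp
  \<comment> \<open>The identity contributes u itself, with its pole at infinity: the last of the
    q^3 + 1 rational places.\<close>
  moreover have "(\<lambda>\<sigma>. \<sigma> u) ` (insert id (\<tau> ` rational_points)) = insert u ((\<lambda>P. \<tau> P u) ` rational_points)"
    by (auto simp: image_image)
  moreover have "insert id (\<tau> ` rational_points) \<subseteq> Aut"
    using \<tau>(1) by (auto simp: field_automorphisms_def is_ring_hom_def)
  ultimately show ?thesis using that by metis
qed

lemma fixed_in_K_t:
  assumes f: "\<And>\<sigma>. \<sigma> \<in> Aut \<Longrightarrow> \<sigma> f = f"
  shows "f \<in> K t"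
proof -
  obtain S where S: "S \<subseteq> Aut" "card ((\<lambda>\<sigma>. \<sigma> u) ` S) = q ^ 3 + 1" by (rule conjugates_of_u)
  define g :: "'f poly" where "g = monom 1 (q + 1) + (monom 1 q + 1)"
  \<comment> \<open>The formula for t with its denominator cleared. The degree (q + 1) (q^2 - q + 1)
    = q^3 + 1 of the first summand exceeds that of the second by at least one, so t does not enter
    the leading coefficient.\<close>
  define m where "m = g ^ (q ^ 2 - q + 1) - monom t (q ^ 3)"
  have "t \<in> K t" by (simp add: field_adjoin_gen)
  then have m: "coeffs_in (K t) m" unfolding m_def g_def
    by (intro coeffs_in_intros is_subfieldD is_subfield_field_adjoin)
  have "degree (monom 1 q + 1 :: 'f poly) < q + 1"
    by (intro degree_add_less le_less_trans[OF degree_monom_le]) auto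
  then have "degree g = q + 1" unfolding g_def by (subst degree_add_eq_left) (auto simp: degree_monom_eq)
  moreover have "(q + 1) * (q ^ 2 - q + 1) = q ^ 3 + 1"
  proof -
    have "q \<le> q ^ 2" by (simp add: power2_eq_square)
    then obtain k where k: "q ^ 2 = q + k" using le_Suc_ex by blast
    have "q ^ 3 = q * (q + k)" unfolding k[symmetric] by (simp add: power3_eq_cube power2_eq_square)
    then show ?thesis using k by (simp add: power2_eq_square algebra_simps)
  qed
  moreover have "g \<noteq> 0" using \<open>degree g = q + 1\<close> by auto
  ultimately have "degree (g ^ (q ^ 2 - q + 1)) = q ^ 3 + 1"
    by (metis degree_power_eq mult.commute)
  moreover have "degree (- monom t (q ^ 3)) < q ^ 3 + 1" using degree_monom_le[of t "q ^ 3"] by simp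
  ultimately have deg: "degree m = q ^ 3 + 1"
    unfolding m_def diff_conv_add_uminus by (subst degree_add_eq_left) auto
  have "poly m u = (1 + u ^ q + u ^ (q + 1)) ^ (q ^ 2 - q + 1) - t * u ^ (q ^ 3)"
    by (simp add: m_def g_def poly_monom poly_power add_ac)
  also have "\<dots> = 0" using u_neq_0 unfolding t_eq by simp
  finally have root: "poly m u = 0" .
  have "f \<in> K u" using f by (rule fixed_in_K_u)
  then show ?thesis
    by (intro descent[OF m _ root S(1)]) (use deg S Aut_fixes_t f in auto)
qed

lemma fixed_field_Aut: "fixed_field Aut = K t"
proof
  show "fixed_field Aut \<subseteq> K t" using fixed_in_K_t by (auto simp: fixed_field_def)
  show "K t \<subseteq> fixed_field Aut"
  proof
    fix f assume f: "f \<in> K t"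
    have "\<sigma> f = f" if \<sigma>: "\<sigma> \<in> Aut" for \<sigma>
      using hom_eq_on_field_adjoin[of \<sigma> id \<iota> "{t}" f] AutD[OF \<sigma>] Aut_fixes_t[OF \<sigma>] f
      by (auto simp: is_ring_hom_def)
    then show "f \<in> fixed_field Aut" by (simp add: fixed_field_def)
  qed
qed

end

theorem theorem1:
  fixes p h q :: nat
    and \<iota> :: "'k::alg_closed_field \<Rightarrow> 'f::field"
    and x y :: 'f
  assumes "prime p" and "h \<ge> 1" and "q = p ^ h" and "q \<noteq> 2"
    and "CHAR('k) = p"
    and "hermitian_function_field q \<iota> x y"
  shows "fixed_field (field_automorphisms \<iota>) = field_adjoin \<iota> {hermitian_t q x y}"
proof -
  interpret hermitian p h q \<iota> x y by standard (use assms in auto)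
  show ?thesis using fixed_field_Aut unfolding t_def .
qed

end
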